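(* Assume conditions PLG1–PLG4, compact Bayes–minimax duality, and the posterior Dirichlet identity (all stated in the context). Then there are deterministic errors $\eta_{0,n}(H),\eta_{1,n}(H)$ and a constant $C$ such that, uniformly over $v\in\mathcal K$ and over all priors $\pi$ on $[-H,H]$, \[ |r^E_{n,v}(\pi)-r^G_v(\pi)|\le\eta_{0,n}(H),\qquad \Big|\partial_v r^E_{n,v}(\pi)-\mathbb E^G_\pi\big[(w^G_v(Y)/v)^2\big]\Big|\le\eta_{1,n}(H), \] with \[ \eta_{0,n}(H)\le C\big[H^2\varepsilon_n(H)+\kappa_n(1+H^3)+H^2\{\tau_n(H)+b_n(H)\}\big], \] \[ \eta_{1,n}(H)\le C\big[H^4\varepsilon_n(H)+\kappa_n(1+H^5)+H^4\{\tau_n(H)+b_n(H)+\gamma_n(H)\}+\chi_n(H)+\tau^\Gamma_n(H)\big]. \] Moreover, $0\le\partial_v r^E_{n,v}(\pi)\le C_{\mathcal K}H^4+C\eta_{1,n}(H)$. Consequently, if $H\ge1$ and $\eta_{1,n}(H)\to0$, the conditions imply the Differentiated Gaussian Transfer property (stated in the context) after enlarging $C_{\mathcal K}$.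
   Context: Gaussian reference. For $v>0$: $Y=h+\sqrt v\,Z$, $Z\sim N(0,1)$, $|h|\le H$. For a prior (probability measure) $\pi$ on $[-H,H]$, $r^G_v(\pi)$ is the Bayes risk for estimating $h$ under squared error, $w^G_v(Y)$ the posterior variance of $h$, and $\mathbb E^G_\pi$ the expectation under $h\sim\pi$. $\phi_v$ is the $N(0,v)$ density and $g_{v,h}(y)=\phi_v(y-h)$. Experiment. $\mathcal K$ is a compact interval in $(0,\infty)$ of inverse-information levels. For $v\in\mathcal K$ the experiment has a common countable state space $\mathcal Z_n$ and mass functions $p_{n,v,h}(z)$, $|h|\le H$, with law $\mathbb P_{n,v,h}$ of $Z$. $R^E_{n,H}(v)$ and $r^E_{n,v}(\pi)$ denote its minimax and Bayes squared-error risks for the target $h$. Increasing $v$ is a parameter-free Markov degradation with generator $\mathcal L_{n,v}f(z)=\sum_{z'}q_{n,v}(z,z')\{f(z')-f(z)\}$, so that $\partial_vp_{n,v,h}=p_{n,v,h}\mathcal L_{n,v}$; the masses have common positive support along every active edge (pair $(z,z')$, $z\neq z'$, with $q_{n,v}(z,z')>0$). An embedding $t_{n,v}:\mathcal Z_n\to\mathbb R$ is given; each $z$ has a quadrature cell $Q_{n,v}(z)$ (an interval) of length $a_{n,v}(z)$, the cell interiors are disjoint, $t_{n,v}(z)\in\overline{Q_{n,v}(z)}$, and their union is, up to Lebesgue-null endpoints, an interval $I_{n,v}$. $\mathcal C_{n,H}=\{z:|t_{n,v}(z)|\le C_0H\}$ for a fixed $C_0$. All constants are uniform over $v\in\mathcal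 K$. PLG1. There is $\varepsilon_n(H)\le1$ with $\big|\log\frac{p_{n,v,h}(z)}{a_{n,v}(z)g_{v,h}\{t_{n,v}(z)\}}\big|\le\varepsilon_n(H)$ for all $|h|\le H$, $z\in\mathcal C_{n,H}$. PLG2. For a deterministic $\tau_n(H)$, \[\sup_{|h|\le H}\mathbb P_{n,v,h}(\mathcal C_{n,H}^c)+\sup_{|h|\le H}\mathbb P^G_{v,h}(|Y|>C_0H)+\sup_{|h|\le H}\sum_{z\notin\mathcal C_{n,H}}a_{n,v}(z)g_{v,h}\{t_{n,v}(z)\}\le\tau_n(H),\] and for a deterministic $\tau^\Gamma_n(H)$, $\sup_{|h|\le H}\mathbb E_{n,v,h}\{\mathbf 1_{\mathcal C_{n,H}^c}G_{n,v,H}(Z)\}\le\tau^\Gamma_n(H)$, where $G_{n,v,H}(z)=4H^2\sum_{z'}q_{n,v}(z,z')\min\{1,[\exp\{\Delta_e(H)\}-1]^2\}$, $e=(z,z')$, $\Delta_e(H)=\operatorname{osc}_{|h|\le H}\ell_e(h)$ (sup minus inf), with $\ell_e$ as in PLG4. PLG3. $\sup_z\operatorname{diam}Q_{n,v}(z)\le\kappa_n$ (hence $|\sum_za_{n,v}(z)f\{t_{n,v}(z)\}-\int_{I_{n,v}}f|\le\kappa_n\int_{I_{n,v}}|f'|$ for absolutely continuous integrable $f$), and $\sup_{|h|\le H}\mathbb P^G_{v,h}(Y\notin I_{n,v})\le b_n(H)$. PLG4. For an active edge $e=(z,z')$ write $\ell_e(h)=\log\frac{p_{n,v,h}(z')}{p_{n,v,h}(z)}=\ell_e(0)+\alpha_eh+\rho_e(h)$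 with $\rho_e(0)=\rho_e'(0)=0$, $\omega_e(H)=\sup_{|h|\le H}|\rho_e(h)|$, $B_e(H)=\alpha_e^2H^2+\omega_e(H)$. For every active edge with origin in $\mathcal C_{n,H}$, $|\alpha_e|H+2\omega_e(H)\le c_0$ with $c_0$ fixed. With $\Xi_{n,v,H}(z)=\sum_{z'}q_{n,v}(z,z')\{|\alpha_e|H^3B_e(H)+H^2B_e(H)^2\}$, on $\mathcal C_{n,H}$: $\big|\sum_{z'}q_{n,v}(z,z')\alpha_e^2-v^{-2}\big|\le\gamma_n(H)$ and $\Xi_{n,v,H}(z)\le\chi_n(H)$. Compact Bayes–minimax duality: $R^E_{n,H}(v)=\sup_\pi r^E_{n,v}(\pi)$ over priors on $[-H,H]$, with an attaining prior. Posterior Dirichlet identity: for every prior, with $m(z)=\mathbb E_\pi(h\mid Z=z)$, $r^E_{n,v}(\pi)$ is differentiable in $v$ and $\partial_vr^E_{n,v}(\pi)=\mathbb E_\pi\sum_{z'}q_{n,v}(Z,z')\{m(z')-m(Z)\}^2$. Differentiated Gaussian Transfer: uniformly over $v\in\mathcal K$, all priors on $[-H,H]$, and the stated range of $H=H_n$: (1) the duality above with an attaining least-favorable prior; (2) every Bayes risk is differentiable in $v$ with $0\le\partial_vr^E_{n,v}(\pi)\le C_{\mathcal K}H^4$; (3) there are deterministic $\eta_{0,n}(H),\eta_{1,n}(H)$ with $|r^E_{n,v}(\pi)-r^G_v(\pi)|\le\eta_{0,n}(H)$ and $|\partial_vr^E_{n,v}(\pi)-\mathbb E^G_\pi[(w^G_v(Y)/v)^2]|\le\eta_{1,n}(H)$.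 *)

theory Defs
  imports "HOL-Probability.Probability"
begin

section \<open>Estimation of a bounded real parameter under squared error\<close>

definition prior :: "real \<Rightarrow> real measure \<Rightarrow> bool" where
  "prior H \<pi> \<longleftrightarrow> prob_space \<pi> \<and> sets \<pi> = sets (restrict_space borel {-H..H})"

text \<open>A statistical experiment is a family \<open>M h\<close> of laws on the measurable space \<open>N\<close>.
  Risks are extended nonnegative reals, so that estimators of infinite risk are admitted.\<close>

definition sq_risk :: "(real \<Rightarrow> 'y measure) \<Rightarrow> ('y \<Rightarrow> real) \<Rightarrow> real \<Rightarrow> ennreal" where
  "sq_risk M \<delta> h = (\<integral>\<^sup>+y. ennreal ((\<delta> y - h)\<^sup>2) \<partial>M h)"

definition bayes_risk :: "'y measure \<Rightarrow> (real \<Rightarrow> 'y measure) \<Rightarrow> real measure \<Rightarrow> ennreal" where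
  "bayes_risk N M \<pi> = (INF \<delta>\<in>borel_measurable N. \<integral>\<^sup>+h. sq_risk M \<delta> h \<partial>\<pi>)"

definition minimax_risk :: "'y measure \<Rightarrow> (real \<Rightarrow> 'y measure) \<Rightarrow> real \<Rightarrow> ennreal" where
  "minimax_risk N M H = (INF \<delta>\<in>borel_measurable N. SUP h\<in>{-H..H}. sq_risk M \<delta> h)"

text \<open>Posterior mean and variance by Bayes' formula; \<open>L h y\<close> is the likelihood.\<close>

definition post_mean :: "real measure \<Rightarrow> (real \<Rightarrow> 'y \<Rightarrow> real) \<Rightarrow> 'y \<Rightarrow> real" where
  "post_mean \<pi> L y = (LINT h|\<pi>. h * L h y) / (LINT h|\<pi>. L h y)"

definition post_var :: "real measure \<Rightarrow> (real \<Rightarrow> 'y \<Rightarrow> real) \<Rightarrow> 'y \<Rightarrow> real" where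
  "post_var \<pi> L y = (LINT h|\<pi>. (h - post_mean \<pi> L y)\<^sup>2 * L h y) / (LINT h|\<pi>. L h y)"


section \<open>Gaussian reference experiment\<close>

definition gauss :: "real \<Rightarrow> real \<Rightarrow> real \<Rightarrow> real" where
  "gauss v h y = normal_density 0 (sqrt v) (y - h)"

definition gauss_law :: "real \<Rightarrow> real \<Rightarrow> real measure" where
  "gauss_law v h = density lborel (\<lambda>y. ennreal (gauss v h y))"

definition risk_G :: "real \<Rightarrow> real measure \<Rightarrow> real" where
  "risk_G v \<pi> = enn2real (bayes_risk borel (gauss_law v) \<pi>)"

text \<open>Expectation, under \<open>h \<sim> \<pi>\<close>, of the squared posterior variance divided by \<open>v\<^sup>2\<close>.\<close>

definition gauss_energy :: "real \<Rightarrow> real measure \<Rightarrow> real" where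
  "gauss_energy v \<pi> =
     (LINT h|\<pi>. LINT y|gauss_law v h. (post_var \<pi> (gauss v) y / v)\<^sup>2)"


section \<open>Discrete experiments\<close>

text \<open>The data at a fixed index \<open>n\<close>. The argument \<open>v\<close> always comes first:
  \<open>law E v h\<close> is the law of the observation, \<open>rate E v z z'\<close> the jump rate \<open>q\<close>
  (its diagonal values are never used), \<open>emb E v\<close> the embedding \<open>t\<close>, \<open>cell E v z\<close> the
  quadrature cell \<open>Q\<close> and \<open>window E v\<close> the interval \<open>I\<close>.\<close>

record 'z plg_model =
  states :: "'z set"
  law :: "real \<Rightarrow> real \<Rightarrow> 'z pmf"
  rate :: "real \<Rightarrow> 'z \<Rightarrow> 'z \<Rightarrow> real"
  emb :: "real \<Rightarrow> 'z \<Rightarrow> real"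
  cell :: "real \<Rightarrow> 'z \<Rightarrow> real set"
  window :: "real \<Rightarrow> real set"

definition len :: "'z plg_model \<Rightarrow> real \<Rightarrow> 'z \<Rightarrow> real" where
  "len E v z = measure lborel (cell E v z)"

definition lik :: "'z plg_model \<Rightarrow> real \<Rightarrow> real \<Rightarrow> 'z \<Rightarrow> real" where
  "lik E v h z = pmf (law E v h) z"

definition core :: "real \<Rightarrow> 'z plg_model \<Rightarrow> real \<Rightarrow> real \<Rightarrow> 'z set" where
  "core C0 E v H = {z \<in> states E. \<bar>emb E v z\<bar> \<le> C0 * H}"

definition active :: "'z plg_model \<Rightarrow> real \<Rightarrow> 'z \<Rightarrow> 'z \<Rightarrow> bool" where
  "active E v z z' \<longleftrightarrow> z \<in> states E \<and> z' \<in> states E \<and> z \<noteq> z' \<and> 0 < rate E v z z'"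

definition succs :: "'z plg_model \<Rightarrow> real \<Rightarrow> 'z \<Rightarrow> 'z set" where
  "succs E v z = {z'. active E v z z'}"

text \<open>Matrix of the generator \<open>f \<mapsto> (\<lambda>z. \<Sum>z'. q z z' * (f z' - f z))\<close>.\<close>

definition gen :: "'z plg_model \<Rightarrow> real \<Rightarrow> 'z \<Rightarrow> 'z \<Rightarrow> real" where
  "gen E v z z' =
     (if z' = z then - (\<Sum>\<^sub>\<infinity>y\<in>states E - {z}. rate E v z y) else rate E v z z')"

text \<open>The transition laws \<open>T u v z\<close>, from level \<open>u\<close> to level \<open>v \<ge> u\<close>, do not depend on \<open>h\<close>.
  The last conjunct of \<open>degradation\<close> is the forward equation: the row vector of masses times
  the generator matrix is the derivative of the masses in \<open>v\<close>. Derivatives at the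
  endpoints of \<open>K\<close> are one-sided.\<close>

definition degradation :: "real set \<Rightarrow> 'z plg_model \<Rightarrow> real \<Rightarrow> bool" where
  "degradation K E H \<longleftrightarrow>
     (\<forall>v\<in>K. \<forall>z\<in>states E.
        (\<forall>z'\<in>states E - {z}. 0 \<le> rate E v z z') \<and> rate E v z summable_on (states E - {z})) \<and>
     (\<exists>T :: real \<Rightarrow> real \<Rightarrow> 'z \<Rightarrow> 'z pmf.
        (\<forall>u\<in>K. \<forall>v\<in>K. u \<le> v \<longrightarrow>
           (\<forall>z\<in>states E. set_pmf (T u v z) \<subseteq> states E) \<and>
           (\<forall>h\<in>{-H..H}. law E v h = bind_pmf (law E u h) (T u v)) \<and>
           (\<forall>w\<in>K. v \<le> w \<longrightarrow> (\<forall>z\<in>states E. T u w z = bind_pmf (T u v z) (T v w)))) \<and>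
        (\<forall>v\<in>K. \<forall>z\<in>states E. T v v z = return_pmf z \<and>
           (\<forall>z'\<in>states E.
              ((\<lambda>u. pmf (T v u z) z') has_real_derivative gen E v z z') (at v within K \<inter> {v..})))) \<and>
     (\<forall>v\<in>K. \<forall>h\<in>{-H..H}. \<forall>z\<in>states E.
        (\<lambda>y. lik E v h y * gen E v y z) summable_on states E \<and>
        ((\<lambda>u. lik E u h z) has_real_derivative
           (\<Sum>\<^sub>\<infinity>y\<in>states E. lik E v h y * gen E v y z)) (at v within K))"

definition quadrature_cells :: "real set \<Rightarrow> 'z plg_model \<Rightarrow> bool" where
  "quadrature_cells K E \<longleftrightarrow>
     (\<forall>v\<in>K.
        (\<forall>z\<in>states E. is_interval (cell E v z) \<and> bounded (cell E v z) \<and>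
                      emb E v z \<in> closure (cell E v z)) \<and>
        disjoint_family_on (\<lambda>z. interior (cell E v z)) (states E) \<and>
        is_interval (window E v) \<and>
        sym_diff (\<Union>z\<in>states E. cell E v z) (window E v) \<in> null_sets lborel)"

text \<open>Measurability of the masses in \<open>h\<close> says that \<open>law E v\<close> is a Markov kernel, which
  is what makes Bayes risks and posteriors meaningful for arbitrary priors.\<close>

definition lattice_experiment :: "real set \<Rightarrow> 'z plg_model \<Rightarrow> real \<Rightarrow> bool" where
  "lattice_experiment K E H \<longleftrightarrow>
     countable (states E) \<and>
     (\<forall>v\<in>K. \<forall>h\<in>{-H..H}. set_pmf (law E v h) \<subseteq> states E) \<and>
     (\<forall>v\<in>K. \<forall>z\<in>states E. (\<lambda>h. lik E v h z) \<in> borel_measurable (restrict_space borel {-H..H})) \<and>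
     degradation K E H \<and>
     (\<forall>v\<in>K. \<forall>z z'. active E v z z' \<longrightarrow> (\<forall>h\<in>{-H..H}. 0 < lik E v h z \<and> 0 < lik E v h z')) \<and>
     quadrature_cells K E"

definition law_E :: "'z plg_model \<Rightarrow> real \<Rightarrow> real \<Rightarrow> 'z measure" where
  "law_E E v h = measure_pmf (law E v h)"

definition risk_E :: "'z plg_model \<Rightarrow> real \<Rightarrow> real measure \<Rightarrow> real" where
  "risk_E E v \<pi> = enn2real (bayes_risk (count_space UNIV) (law_E E v) \<pi>)"


section \<open>Likelihood ratios along active edges\<close>

definition llr :: "'z plg_model \<Rightarrow> real \<Rightarrow> 'z \<Rightarrow> 'z \<Rightarrow> real \<Rightarrow> real" where
  "llr E v z z' h = ln (lik E v h z' / lik E v h z)"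

definition slope :: "'z plg_model \<Rightarrow> real \<Rightarrow> 'z \<Rightarrow> 'z \<Rightarrow> real" where
  "slope E v z z' = deriv (llr E v z z') 0"

definition remainder :: "'z plg_model \<Rightarrow> real \<Rightarrow> 'z \<Rightarrow> 'z \<Rightarrow> real \<Rightarrow> real" where
  "remainder E v z z' h = llr E v z z' h - llr E v z z' 0 - slope E v z z' * h"

text \<open>The suprema below may be infinite on edges that leave the complement of the core;
  hence they are taken in \<open>ennreal\<close> and \<open>ereal\<close>.\<close>

definition omega :: "'z plg_model \<Rightarrow> real \<Rightarrow> real \<Rightarrow> 'z \<Rightarrow> 'z \<Rightarrow> ennreal" where
  "omega E v H z z' = (SUP h\<in>{-H..H}. ennreal \<bar>remainder E v z z' h\<bar>)"

definition bigB :: "'z plg_model \<Rightarrow> real \<Rightarrow> real \<Rightarrow> 'z \<Rightarrow> 'z \<Rightarrow> ennreal" where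
  "bigB E v H z z' = ennreal ((slope E v z z')\<^sup>2 * H\<^sup>2) + omega E v H z z'"

definition Xi :: "'z plg_model \<Rightarrow> real \<Rightarrow> real \<Rightarrow> 'z \<Rightarrow> ennreal" where
  "Xi E v H z = (\<integral>\<^sup>+z'. ennreal (rate E v z z') *
      (ennreal (\<bar>slope E v z z'\<bar> * H ^ 3) * bigB E v H z z' + ennreal (H\<^sup>2) * (bigB E v H z z')\<^sup>2)
      \<partial>count_space (succs E v z))"

definition llr_osc :: "'z plg_model \<Rightarrow> real \<Rightarrow> real \<Rightarrow> 'z \<Rightarrow> 'z \<Rightarrow> ereal" where
  "llr_osc E v H z z' =
     (SUP h\<in>{-H..H}. ereal (llr E v z z' h)) - (INF h\<in>{-H..H}. ereal (llr E v z z' h))"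

text \<open>\<open>min {1, (exp \<Delta> - 1)\<^sup>2}\<close> with \<open>exp \<infinity> = \<infinity>\<close>.\<close>

definition osc_weight :: "ereal \<Rightarrow> real" where
  "osc_weight \<Delta> = (if \<Delta> = \<infinity> then 1 else min 1 ((exp (real_of_ereal \<Delta>) - 1)\<^sup>2))"

definition Gam :: "'z plg_model \<Rightarrow> real \<Rightarrow> real \<Rightarrow> 'z \<Rightarrow> ennreal" where
  "Gam E v H z = ennreal (4 * H\<^sup>2) *
     (\<integral>\<^sup>+z'. ennreal (rate E v z z' * osc_weight (llr_osc E v H z z')) \<partial>count_space (succs E v z))"


section \<open>The conditions, at a fixed index and a fixed \<open>H\<close>\<close>

text \<open>Since \<open>ln 0 = 0\<close>, finiteness of the logarithm is stated as positivity of its argument.\<close>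

definition PLG1 :: "real set \<Rightarrow> real \<Rightarrow> 'z plg_model \<Rightarrow> real \<Rightarrow> real \<Rightarrow> bool" where
  "PLG1 K C0 E H \<epsilon> \<longleftrightarrow> 0 \<le> \<epsilon> \<and> \<epsilon> \<le> 1 \<and>
     (\<forall>v\<in>K. \<forall>h\<in>{-H..H}. \<forall>z\<in>core C0 E v H.
        0 < len E v z \<and> 0 < lik E v h z \<and>
        \<bar>ln (lik E v h z / (len E v z * gauss v h (emb E v z)))\<bar> \<le> \<epsilon>)"

definition PLG2 :: "real set \<Rightarrow> real \<Rightarrow> 'z plg_model \<Rightarrow> real \<Rightarrow> real \<Rightarrow> real \<Rightarrow> bool" where
  "PLG2 K C0 E H \<tau> \<tau>\<Gamma> \<longleftrightarrow> 0 \<le> \<tau> \<and> 0 \<le> \<tau>\<Gamma> \<and>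
     (\<forall>v\<in>K.
        (SUP h\<in>{-H..H}. emeasure (law_E E v h) (- core C0 E v H)) +
        (SUP h\<in>{-H..H}. emeasure (gauss_law v h) {y. C0 * H < \<bar>y\<bar>}) +
        (SUP h\<in>{-H..H}. \<integral>\<^sup>+z. ennreal (len E v z * gauss v h (emb E v z))
                          \<partial>count_space (states E - core C0 E v H)) \<le> ennreal \<tau> \<and>
        (SUP h\<in>{-H..H}. \<integral>\<^sup>+z. indicator (- core C0 E v H) z * Gam E v H z \<partial>law_E E v h)
          \<le> ennreal \<tau>\<Gamma>)"

definition PLG3 :: "real set \<Rightarrow> 'z plg_model \<Rightarrow> real \<Rightarrow> real \<Rightarrow> real \<Rightarrow> bool" where
  "PLG3 K E H \<kappa> \<beta> \<longleftrightarrow>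
     (\<forall>v\<in>K. (\<forall>z\<in>states E. diameter (cell E v z) \<le> \<kappa>) \<and>
            (\<forall>h\<in>{-H..H}. measure (gauss_law v h) (- window E v) \<le> \<beta>))"

text \<open>The first conjunct under \<open>\<forall>v\<in>K\<close> is the expansion of the log-likelihood ratio at \<open>0\<close>:
  it says that the ratio is differentiable there, with derivative \<open>slope\<close>.\<close>

definition PLG4 :: "real set \<Rightarrow> real \<Rightarrow> real \<Rightarrow> 'z plg_model \<Rightarrow> real \<Rightarrow> real \<Rightarrow> real \<Rightarrow> bool" where
  "PLG4 K C0 c0 E H \<gamma> \<xi> \<longleftrightarrow> 0 \<le> \<gamma> \<and> 0 \<le> \<xi> \<and>
     (\<forall>v\<in>K.
        (\<forall>z z'. active E v z z' \<longrightarrow> (remainder E v z z' has_real_derivative 0) (at 0)) \<and>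
        (\<forall>z\<in>core C0 E v H.
           (\<forall>z'. active E v z z' \<longrightarrow>
              ennreal (\<bar>slope E v z z'\<bar> * H) + 2 * omega E v H z z' \<le> ennreal c0) \<and>
           (\<lambda>z'. rate E v z z' * (slope E v z z')\<^sup>2) summable_on succs E v z \<and>
           \<bar>(\<Sum>\<^sub>\<infinity>z'\<in>succs E v z. rate E v z z' * (slope E v z z')\<^sup>2) - 1 / v\<^sup>2\<bar> \<le> \<gamma> \<and>
           Xi E v H z \<le> ennreal \<xi>))"

definition bayes_minimax_duality :: "real set \<Rightarrow> 'z plg_model \<Rightarrow> real \<Rightarrow> bool" where
  "bayes_minimax_duality K E H \<longleftrightarrow>
     (\<forall>v\<in>K.
        minimax_risk (count_space UNIV) (law_E E v) H =
          (SUP \<pi>\<in>{\<pi>. prior H \<pi>}. bayes_risk (count_space UNIV) (law_E E v) \<pi>) \<and>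
        (\<exists>\<pi>. prior H \<pi> \<and>
          bayes_risk (count_space UNIV) (law_E E v) \<pi> =
            minimax_risk (count_space UNIV) (law_E E v) H))"

definition dirichlet_energy :: "'z plg_model \<Rightarrow> real \<Rightarrow> real measure \<Rightarrow> ennreal" where
  "dirichlet_energy E v \<pi> = (\<integral>\<^sup>+h. \<integral>\<^sup>+z. \<integral>\<^sup>+z'.
      ennreal (rate E v z z' * (post_mean \<pi> (lik E v) z' - post_mean \<pi> (lik E v) z)\<^sup>2)
      \<partial>count_space (succs E v z) \<partial>law_E E v h \<partial>\<pi>)"

definition posterior_dirichlet_identity :: "real set \<Rightarrow> 'z plg_model \<Rightarrow> real \<Rightarrow> bool" where
  "posterior_dirichlet_identity K E H \<longleftrightarrow>
     (\<forall>\<pi>. prior H \<pi> \<longrightarrow> (\<forall>v\<in>K. dirichlet_energy E v \<pi> < \<infinity> \<and>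
        ((\<lambda>u. risk_E E u \<pi>) has_real_derivative enn2real (dirichlet_energy E v \<pi>)) (at v within K)))"


section \<open>Differentiated Gaussian Transfer\<close>

text \<open>\<open>R n\<close> is the range of \<open>H\<close> allowed at index \<open>n\<close>; all bounds are uniform over it.\<close>

definition DGT :: "real set \<Rightarrow> (nat \<Rightarrow> 'z plg_model) \<Rightarrow> (nat \<Rightarrow> real set) \<Rightarrow> real \<Rightarrow>
    (nat \<Rightarrow> real \<Rightarrow> real) \<Rightarrow> (nat \<Rightarrow> real \<Rightarrow> real) \<Rightarrow> bool" where
  "DGT K E R CK \<eta>0 \<eta>1 \<longleftrightarrow>
     (\<forall>n. \<forall>H\<in>R n. bayes_minimax_duality K (E n) H \<and>
        (\<forall>v\<in>K. \<forall>\<pi>. prior H \<pi> \<longrightarrow>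
           \<bar>risk_E (E n) v \<pi> - risk_G v \<pi>\<bar> \<le> \<eta>0 n H \<and>
           (\<exists>D. ((\<lambda>u. risk_E (E n) u \<pi>) has_real_derivative D) (at v within K) \<and>
                0 \<le> D \<and> D \<le> CK * H ^ 4 \<and> \<bar>D - gauss_energy v \<pi>\<bar> \<le> \<eta>1 n H)))"

end

(*
  For an observed value, the likelihood f on [-H,H] enters the risk and its derivative through
  two functionals, homogeneous and Lipschitz in L^1 of the prior: the unnormalised variance
  spread f = min_d int (h-d)^2 f and energy f = (spread f)^2 / int f
  = sup_c (2 c spread f - c^2 int f).  Being a minimum resp. a supremum of linear functionals,
  both have Lipschitz constants of order H^2 resp. H^4, without any differentiation of posterior
  quantities.  Hence the discrete sum over states and the Gaussian integral differ by the L^1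
  distance between p_h(z) and the Gaussian mass of the cell, which PLG1-PLG3 bound for each h
  separately; the quadrature error costs the total variation of one Gaussian density.
  The Dirichlet energy is compared with the sum of (posterior variance)^2 / v^2 edge by edge:
  on the core, tilting the posterior by exp (alpha h + rho) moves its mean by alpha times the
  variance up to O(H B); off the core the move is controlled by the oscillation of the
  log-likelihood ratio.
*)

theory Submission
  imports Defs
begin

section \<open>Weights on a bounded parameter interval\<close>

text \<open>The priors are arbitrary, so posterior normalisers can be tiny, and posterior means and
  variances need not be stable for a single observation; multiplied by the marginal mass they are.
  Homogeneity has a second use: a cell length pulls out of the functional, so its value at the cell
  mass of a density frozen at the embedded point is exactly an integral over the cell. Every error
  in passing from sums to integrals is thus a prior average of an error for one fixed h, which gives
  uniformity over priors at once. The Lipschitz factors carry all growth in H: the total variation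
  sqrt (2 / (pi v)) of a Gaussian density is free of H, so quadrature costs terms of order \<kappa>
  H^2 and \<kappa> H^4, which the claimed \<kappa> (1 + H^3) and \<kappa> (1 + H^5) dominate.
  Oscillations may be infinite off the core, and sums over edges and states are extended-valued;
  comparisons are therefore pairs of one-sided inequalities, turned into a bound on an absolute
  difference only once finiteness is known.\<close>

definition mass :: "real measure \<Rightarrow> (real \<Rightarrow> real) \<Rightarrow> real" where
  "mass \<pi> f = (LINT h|\<pi>. f h)"

definition avg :: "real measure \<Rightarrow> (real \<Rightarrow> real) \<Rightarrow> real" where
  "avg \<pi> f = (LINT h|\<pi>. h * f h) / mass \<pi> f"

text \<open>Posterior variance times marginal mass: totalled over the observations it is the Bayes
  risk.\<close>

definition spread :: "real measure \<Rightarrow> (real \<Rightarrow> real) \<Rightarrow> real" where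
  "spread \<pi> f = (LINT h|\<pi>. (h - avg \<pi> f)\<^sup>2 * f h)"

text \<open>Marginal mass times squared posterior variance, so that its total over the observations
  is the expected squared posterior variance. At mass zero the quotient defaults to the right value
  zero.\<close>

definition energy :: "real measure \<Rightarrow> (real \<Rightarrow> real) \<Rightarrow> real" where
  "energy \<pi> f = (spread \<pi> f)\<^sup>2 / mass \<pi> f"

lemma post_mean_eq_avg: "post_mean \<pi> L y = avg \<pi> (\<lambda>h. L h y)"
  by (simp add: post_mean_def avg_def mass_def)

lemma post_var_eq_spread: "post_var \<pi> L y = spread \<pi> (\<lambda>h. L h y) / mass \<pi> (\<lambda>h. L h y)"
  by (simp add: post_var_def spread_def mass_def post_mean_eq_avg)

lemma mass_cmult: "mass \<pi> (\<lambda>h. c * f h) = c * mass \<pi> f"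
  by (simp add: mass_def)

lemma avg_cmult: "c \<noteq> 0 \<Longrightarrow> avg \<pi> (\<lambda>h. c * f h) = avg \<pi> f"
  by (simp add: avg_def mass_cmult mult.left_commute[of _ c])

lemma spread_cmult: "spread \<pi> (\<lambda>h. c * f h) = c * spread \<pi> f"
  by (cases "c = 0") (simp_all add: spread_def avg_cmult mult.left_commute[of _ c])

lemma energy_cmult: "energy \<pi> (\<lambda>h. c * f h) = c * energy \<pi> f"
  by (simp add: energy_def mass_cmult spread_cmult power2_eq_square)

locale bounded_prior =
  fixes H :: real and \<pi> :: "real measure"
  assumes H_pos: "0 < H" and prior: "prior H \<pi>"
begin

sublocale prob_space \<pi>
  using prior by (simp add: prior_def)

lemma sets_\<pi>: "sets \<pi> = sets (restrict_space borel {-H..H})"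
  using prior by (simp add: prior_def)

lemma space_\<pi>: "space \<pi> = {-H..H}"
  using sets_eq_imp_space_eq[OF sets_\<pi>] by (simp add: space_restrict_space)

lemma measurable_\<pi>: "f \<in> borel_measurable (restrict_space borel {-H..H}) \<Longrightarrow> f \<in> borel_measurable \<pi>"
  using measurable_cong_sets[OF sets_\<pi> refl] by blast

lemma measurable_\<pi>_borel: "f \<in> measurable borel M \<Longrightarrow> f \<in> measurable \<pi> M"
  using measurable_cong_sets[OF sets_\<pi> refl] measurable_restrict_space1 by blast

lemma ident_measurable [measurable]: "(\<lambda>h. h) \<in> borel_measurable \<pi>"
  by (rule measurable_\<pi>_borel) simp

definition weight :: "(real \<Rightarrow> real) \<Rightarrow> bool" where
  "weight f \<longleftrightarrow> integrable \<pi> f \<and> (\<forall>h\<in>{-H..H}. 0 \<le> f h)"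

lemma weightD: "weight f \<Longrightarrow> integrable \<pi> f" "weight f \<Longrightarrow> h \<in> {-H..H} \<Longrightarrow> 0 \<le> f h"
  by (auto simp: weight_def)

lemma integrable_bounded_mult:
  fixes f g :: "real \<Rightarrow> real"
  assumes "integrable \<pi> f" "g \<in> borel_measurable \<pi>" "\<And>h. h \<in> {-H..H} \<Longrightarrow> \<bar>g h\<bar> \<le> B"
  shows "integrable \<pi> (\<lambda>h. g h * f h)"
proof (rule Bochner_Integration.integrable_bound[where f = "\<lambda>h. B * f h"])
  show "integrable \<pi> (\<lambda>h. B * f h)" using assms by simp
  show "(\<lambda>h. g h * f h) \<in> borel_measurable \<pi>" using assms by measurable
  show "AE h in \<pi>. norm (g h * f h) \<le> norm (B * f h)"
    using assms(3) by (intro AE_I2) (force simp: space_\<pi> abs_mult intro!: mult_right_mono)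
qed

lemma integrable_poly_mult:
  fixes f :: "real \<Rightarrow> real"
  assumes "integrable \<pi> f"
  shows "integrable \<pi> (\<lambda>h. h * f h)" "integrable \<pi> (\<lambda>h. (h - d)\<^sup>2 * f h)"
    "integrable \<pi> (\<lambda>h. h\<^sup>2 * f h)" "integrable \<pi> (\<lambda>h. (h - d) * f h)"
     apply (rule integrable_bounded_mult[OF assms, of _ H]; force)
    apply (rule integrable_bounded_mult[OF assms, of _ "(H + \<bar>d\<bar>)\<^sup>2"]; force intro!: power2_le_iff_abs_le[THEN iffD2])
   apply (rule integrable_bounded_mult[OF assms, of _ "H\<^sup>2"]; force simp: power2_le_iff_abs_le)
  apply (rule integrable_bounded_mult[OF assms, of _ "H + \<bar>d\<bar>"]; force)
  done

section \<open>Masses and moments of a weight\<close>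

lemma mass_nonneg: "weight f \<Longrightarrow> 0 \<le> mass \<pi> f"
  unfolding mass_def by (rule integral_nonneg_AE) (auto simp: weight_def space_\<pi>)

lemma mass_zero_AE:
  assumes "weight f" "mass \<pi> f = 0"
  shows "AE h in \<pi>. f h = 0"
proof -
  have "AE h in \<pi>. 0 \<le> f h" using assms(1) by (intro AE_I2) (auto simp: weight_def space_\<pi>)
  then show ?thesis
    using assms integral_nonneg_eq_0_iff_AE[OF weightD(1)[OF assms(1)]] by (auto simp: mass_def)
qed

lemma mass_pos:
  assumes "weight f" "\<And>h. h \<in> {-H..H} \<Longrightarrow> 0 < f h"
  shows "0 < mass \<pi> f"
proof (rule ccontr)
  assume "\<not> ?thesis"
  then have "AE h in \<pi>. f h = 0" using mass_zero_AE mass_nonneg assms(1) by force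
  moreover have "AE h in \<pi>. f h \<noteq> 0"
    using assms(2) by (intro AE_I2) (force simp: space_\<pi>)
  ultimately have "AE h in \<pi>. False" by eventually_elim simp
  then show False by simp
qed

text \<open>If the mass is zero, \<open>f\<close> vanishes almost everywhere under the prior and
  both sides are zero, so the default value of the quotient in \<open>avg\<close> does no
  harm.\<close>

lemma first_moment: "weight f \<Longrightarrow> (LINT h|\<pi>. h * f h) = avg \<pi> f * mass \<pi> f"
proof (cases "mass \<pi> f = 0")
  case True
  assume "weight f"
  then have "AE h in \<pi>. h * f h = 0" using mass_zero_AE[OF _ True] by auto
  then have "(LINT h|\<pi>. h * f h) = 0" by (rule integral_eq_zero_AE)
  then show ?thesis using True by simp
qed (simp add: avg_def)

lemma second_moment:
  assumes "weight f"
  shows "(LINT h|\<pi>. (h - d)\<^sup>2 * f h) = (LINT h|\<pi>. h\<^sup>2 * f h) - 2 * d * avg \<pi> f * mass \<pi> f + d\<^sup>2 * mass \<pi> f"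
proof -
  note i = integrable_poly_mult[OF weightD(1)[OF assms]] weightD(1)[OF assms]
  have "(LINT h|\<pi>. (h - d)\<^sup>2 * f h) = (LINT h|\<pi>. h\<^sup>2 * f h - 2 * d * (h * f h) + d\<^sup>2 * f h)"
    by (intro Bochner_Integration.integral_cong) (auto simp: power2_eq_square algebra_simps)
  also have "\<dots> = (LINT h|\<pi>. h\<^sup>2 * f h) - 2 * d * (LINT h|\<pi>. h * f h) + d\<^sup>2 * mass \<pi> f"
    using i by (simp add: mass_def)
  finally show ?thesis using first_moment[OF assms] by simp
qed

lemma spread_eq: "weight f \<Longrightarrow> spread \<pi> f = (LINT h|\<pi>. h\<^sup>2 * f h) - (avg \<pi> f)\<^sup>2 * mass \<pi> f"
  unfolding spread_def second_moment by (simp add: power2_eq_square)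

text \<open>Bias-variance decomposition; its second summand is nonnegative, so \<open>avg\<close> is
  the optimal constant estimate.\<close>

lemma quadratic_loss_eq:
  "weight f \<Longrightarrow> (LINT h|\<pi>. (h - d)\<^sup>2 * f h) = spread \<pi> f + (avg \<pi> f - d)\<^sup>2 * mass \<pi> f"
  unfolding second_moment spread_eq by (simp add: power2_eq_square algebra_simps)

lemma spread_le: "weight f \<Longrightarrow> spread \<pi> f \<le> (LINT h|\<pi>. (h - d)\<^sup>2 * f h)"
  using quadratic_loss_eq[of f d] mass_nonneg by simp

lemma spread_nonneg: "weight f \<Longrightarrow> 0 \<le> spread \<pi> f"
  unfolding spread_def by (rule integral_nonneg_AE) (auto simp: weight_def space_\<pi>)

lemma spread_le_mass: "weight f \<Longrightarrow> spread \<pi> f \<le> H\<^sup>2 * mass \<pi> f"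
proof -
  assume w: "weight f"
  have "(LINT h|\<pi>. (h - 0)\<^sup>2 * f h) \<le> (LINT h|\<pi>. H\<^sup>2 * f h)"
    using w integrable_poly_mult(2)[OF weightD(1)[OF w], of 0] weightD[OF w]
    by (intro integral_mono) (auto simp: space_\<pi> abs_le_iff intro!: mult_right_mono power2_le_iff_abs_le[THEN iffD2])
  then show ?thesis using spread_le[OF w, of 0] by (simp add: mass_def)
qed

lemma avg_bound: "weight f \<Longrightarrow> \<bar>avg \<pi> f\<bar> \<le> H"
proof -
  assume w: "weight f"
  have "\<bar>LINT h|\<pi>. h * f h\<bar> \<le> (LINT h|\<pi>. \<bar>h * f h\<bar>)" by simp
  also have "\<dots> \<le> (LINT h|\<pi>. H * f h)"
  proof (rule integral_mono)
    show "integrable \<pi> (\<lambda>h. \<bar>h * f h\<bar>)"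
      using integrable_poly_mult(1)[OF weightD(1)[OF w]] by (rule integrable_abs)
    show "integrable \<pi> (\<lambda>h. H * f h)" using weightD(1)[OF w] by simp
    show "\<bar>h * f h\<bar> \<le> H * f h" if "h \<in> space \<pi>" for h
      using that weightD(2)[OF w, of h] by (auto simp: space_\<pi> abs_mult intro!: mult_right_mono)
  qed
  finally have "\<bar>LINT h|\<pi>. h * f h\<bar> \<le> H * mass \<pi> f" by (simp add: mass_def)
  then show ?thesis using mass_nonneg[OF w] H_pos
    by (cases "mass \<pi> f = 0") (auto simp: avg_def abs_divide field_simps)
qed

lemma dev_bound: "weight f \<Longrightarrow> h \<in> {-H..H} \<Longrightarrow> \<bar>h - avg \<pi> f\<bar> \<le> 2 * H"
  using avg_bound[of f] by auto

section \<open>Lipschitz bounds in the L^1 norm of the prior\<close>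

lemma mass_diff:
  assumes "weight f" "weight g"
  shows "\<bar>mass \<pi> f - mass \<pi> g\<bar> \<le> (LINT h|\<pi>. \<bar>f h - g h\<bar>)"
  unfolding mass_def using weightD(1)[OF assms(1)] weightD(1)[OF assms(2)]
    integral_abs_bound[of \<pi> "\<lambda>h. f h - g h"] by (simp add: Bochner_Integration.integral_diff)

text \<open>Both weights are centred at the average of \<open>g\<close>, which is optimal for
  \<open>g\<close> and admissible for \<open>f\<close>. The constant is (2 H)^2, since parameter and
  centre both lie in [-H, H]. Exchanging the weights gives the reverse bound.\<close>

lemma spread_diff1:
  assumes "weight f" "weight g"
  shows "spread \<pi> f - spread \<pi> g \<le> 4 * H\<^sup>2 * (LINT h|\<pi>. \<bar>f h - g h\<bar>)"
proof -
  note i = weightD(1)[OF assms(1)] weightD(1)[OF assms(2)]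
  let ?m = "avg \<pi> g"
  have "spread \<pi> f - spread \<pi> g \<le> (LINT h|\<pi>. (h - ?m)\<^sup>2 * f h) - (LINT h|\<pi>. (h - ?m)\<^sup>2 * g h)"
    using spread_le[OF assms(1), of ?m] by (simp add: spread_def[of _ g])
  also have "\<dots> = (LINT h|\<pi>. (h - ?m)\<^sup>2 * (f h - g h))"
    using i integrable_poly_mult(2) by (simp add: right_diff_distrib)
  also have "\<dots> \<le> (LINT h|\<pi>. (4 * H\<^sup>2) * \<bar>f h - g h\<bar>)"
  proof (rule integral_mono)
    show "integrable \<pi> (\<lambda>h. (h - ?m)\<^sup>2 * (f h - g h))" using i by (intro integrable_poly_mult) auto
    show "integrable \<pi> (\<lambda>h. 4 * H\<^sup>2 * \<bar>f h - g h\<bar>)" using i by auto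
    fix h assume "h \<in> space \<pi>"
    then have "(h - ?m)\<^sup>2 \<le> (2 * H)\<^sup>2"
      using dev_bound[OF assms(2)] H_pos by (intro power2_le_iff_abs_le[THEN iffD2]) (auto simp: space_\<pi>)
    then have "(h - ?m)\<^sup>2 * \<bar>f h - g h\<bar> \<le> 4 * H\<^sup>2 * \<bar>f h - g h\<bar>"
      by (intro mult_right_mono) (auto simp: power_mult_distrib)
    moreover have "(h - ?m)\<^sup>2 * (f h - g h) \<le> (h - ?m)\<^sup>2 * \<bar>f h - g h\<bar>"
      by (intro mult_left_mono) auto
    ultimately show "(h - ?m)\<^sup>2 * (f h - g h) \<le> 4 * H\<^sup>2 * \<bar>f h - g h\<bar>" by linarith
  qed
  finally show ?thesis by simp
qed

text \<open>Completing the square in \<open>spread \<pi> f - c * mass \<pi> f\<close>. At mass zero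
  the spread vanishes too, being at most H^2 times the mass.\<close>

lemma energy_ge: "weight f \<Longrightarrow> 2 * c * spread \<pi> f - c\<^sup>2 * mass \<pi> f \<le> energy \<pi> f"
proof -
  assume w: "weight f"
  show ?thesis
  proof (cases "mass \<pi> f = 0")
    case True
    then show ?thesis using spread_le_mass[OF w] spread_nonneg[OF w] by (simp add: energy_def)
  next
    case False
    then have p: "0 < mass \<pi> f" using mass_nonneg[OF w] by simp
    have "0 \<le> (spread \<pi> f - c * mass \<pi> f)\<^sup>2" by simp
    then show ?thesis using p by (simp add: energy_def field_simps power2_eq_square)
  qed
qed

lemma energy_nonneg: "weight f \<Longrightarrow> 0 \<le> energy \<pi> f"
  using mass_nonneg by (simp add: energy_def)

lemma energy_le_mass: "weight f \<Longrightarrow> energy \<pi> f \<le> H ^ 4 * mass \<pi> f"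
proof -
  assume w: "weight f"
  have "(spread \<pi> f)\<^sup>2 \<le> (H\<^sup>2 * mass \<pi> f)\<^sup>2"
    using spread_le_mass[OF w] spread_nonneg[OF w] by (rule power_mono)
  then show ?thesis using mass_nonneg[OF w]
    by (cases "mass \<pi> f = 0") (auto simp: energy_def field_simps power2_eq_square power4_eq_xxxx)
qed

text \<open>The value of \<open>c\<close> that is optimal for \<open>f\<close>, namely its variance,
  is used for both weights. As \<open>c\<close> is at most H^2, the change of the spread contributes
  8 H^4 and the change of the mass H^4, together 9 H^4.\<close>

lemma energy_diff1:
  assumes "weight f" "weight g"
  shows "energy \<pi> f - energy \<pi> g \<le> 9 * H ^ 4 * (LINT h|\<pi>. \<bar>f h - g h\<bar>)"
proof -
  define c where "c = spread \<pi> f / mass \<pi> f"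
  let ?d = "LINT h|\<pi>. \<bar>f h - g h\<bar>"
  have c: "0 \<le> c" "c \<le> H\<^sup>2"
    using spread_le_mass[OF assms(1)] spread_nonneg[OF assms(1)] mass_nonneg[OF assms(1)]
    by (cases "mass \<pi> f = 0"; auto simp: c_def field_simps)+
  have "energy \<pi> f = 2 * c * spread \<pi> f - c\<^sup>2 * mass \<pi> f"
    by (cases "mass \<pi> f = 0") (auto simp: energy_def c_def field_simps power2_eq_square)
  then have "energy \<pi> f - energy \<pi> g \<le> 2 * c * (spread \<pi> f - spread \<pi> g) + c\<^sup>2 * (mass \<pi> g - mass \<pi> f)"
    using energy_ge[OF assms(2), of c] by (simp add: algebra_simps)
  also have "\<dots> \<le> 2 * c * (4 * H\<^sup>2 * ?d) + c\<^sup>2 * ?d"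
    using spread_diff1[OF assms] mass_diff[OF assms] c
    by (intro add_mono mult_left_mono) auto
  also have "\<dots> \<le> 2 * H\<^sup>2 * (4 * H\<^sup>2 * ?d) + (H\<^sup>2)\<^sup>2 * ?d"
    using c by (intro add_mono mult_right_mono mult_left_mono power_mono) auto
  also have "\<dots> = 9 * H ^ 4 * ?d" by (simp add: power2_eq_square power4_eq_xxxx)
  finally show ?thesis .
qed

end

section \<open>Tilting a weight along an edge\<close>

lemma abs_exp_minus_one_le: "\<bar>exp x - 1\<bar> \<le> \<bar>x\<bar> * exp \<bar>x\<bar>" for x :: real
proof (cases "0 \<le> x")
  case True
  have "(1 - x) * exp x \<le> exp (- x) * exp x"
    using exp_ge_add_one_self[of "- x"] by (intro mult_right_mono) auto
  then have "exp x - 1 \<le> x * exp x" by (simp add: exp_minus algebra_simps)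
  then show ?thesis using True by simp
next
  case False
  have "1 - exp x \<le> - x" using exp_ge_add_one_self[of x] by linarith
  also have "\<dots> \<le> - x * exp (- x)" using False mult_left_mono[of 1 "exp (- x)" "- x"] by simp
  finally show ?thesis using False by simp
qed

lemma abs_exp_minus_one_minus_le: "\<bar>exp x - 1 - x\<bar> \<le> x\<^sup>2 * exp \<bar>x\<bar>" for x :: real
proof -
  have "(1 - x) * exp x \<le> exp (- x) * exp x"
    using exp_ge_add_one_self[of "- x"] by (intro mult_right_mono) auto
  then have "exp x - 1 - x \<le> x * (exp x - 1)" by (simp add: exp_minus algebra_simps)
  also have "\<dots> \<le> \<bar>x\<bar> * \<bar>exp x - 1\<bar>" by (metis abs_ge_self abs_mult)
  also have "\<dots> \<le> \<bar>x\<bar> * (\<bar>x\<bar> * exp \<bar>x\<bar>)" by (intro mult_left_mono abs_exp_minus_one_le) auto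
  also have "\<dots> = x\<^sup>2 * exp \<bar>x\<bar>" by (simp add: power2_eq_square flip: mult.assoc)
  finally show ?thesis using exp_ge_add_one_self[of x] by linarith
qed

text \<open>The bracket bounds the pointwise remainder of the tilt expansion in units of H B: 2 (2 +
  c) + (1 + c) = 5 + 3 c collects the exponential remainders, and 2 comes from the nonlinear part of
  the exponent. The outer \<open>exp c\<close> is the price of normalising by the tilted mass, which
  can be smaller than the original one by that factor.\<close>

definition edge_const :: "real \<Rightarrow> real" where
  "edge_const c = exp c * (2 + (5 + 3 * c) * exp c)"

lemma edge_const_nonneg: "0 \<le> c \<Longrightarrow> 0 \<le> edge_const c"
  by (simp add: edge_const_def)

context bounded_prior
begin

lemma centered_moment: "weight f \<Longrightarrow> (LINT h|\<pi>. (h - d) * f h) = (avg \<pi> f - d) * mass \<pi> f"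
  using integrable_poly_mult(1)[OF weightD(1)] weightD(1)[of f] first_moment[of f]
  by (simp add: left_diff_distrib mass_def)

lemma centered_product_moment:
  assumes "weight f"
  shows "(LINT h|\<pi>. (h - avg \<pi> f) * h * f h) = spread \<pi> f"
proof -
  note i = integrable_poly_mult[OF weightD(1)[OF assms]]
  have "(LINT h|\<pi>. (h - avg \<pi> f) * h * f h) =
      (LINT h|\<pi>. (h - avg \<pi> f)\<^sup>2 * f h + avg \<pi> f * ((h - avg \<pi> f) * f h))"
    by (intro Bochner_Integration.integral_cong) (auto simp: power2_eq_square algebra_simps)
  also have "\<dots> = spread \<pi> f"
    using i centered_moment[OF assms, of "avg \<pi> f"] by (simp add: spread_def)
  finally show ?thesis .
qed

text \<open>A multiple of \<open>f\<close> has no first moment about the average of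
  \<open>f\<close>, so \<open>g\<close> may be replaced by \<open>g - c * f\<close> there. This lies
  between 0 and \<open>c * (K - 1) * f\<close>, deviations are at most 2 H, and
  \<open>c * mass \<pi> f\<close> is at most the normaliser \<open>mass \<pi> g\<close>.\<close>

lemma avg_diff_sandwich:
  assumes f: "weight f" and g: "weight g" and pos: "0 < mass \<pi> f" and c: "0 < c"
    and sw: "\<And>h. h \<in> {-H..H} \<Longrightarrow> c * f h \<le> g h \<and> g h \<le> c * K * f h"
  shows "\<bar>avg \<pi> g - avg \<pi> f\<bar> \<le> 2 * H * (K - 1)"
proof -
  let ?m = "avg \<pi> f"
  note i = weightD(1)[OF f] weightD(1)[OF g]
  have cm: "c * mass \<pi> f \<le> mass \<pi> g"
    using i sw unfolding mass_def integral_mult_right_zero[symmetric]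
    by (intro integral_mono) (auto simp: space_\<pi>)
  then have gpos: "0 < mass \<pi> g" using pos c by (meson less_le_trans mult_pos_pos)
  have "mass \<pi> g \<le> c * K * mass \<pi> f"
    using i sw unfolding mass_def integral_mult_right_zero[symmetric]
    by (intro integral_mono) (auto simp: space_\<pi>)
  with cm pos c have K: "1 \<le> K"
    by (metis mult.assoc mult_le_cancel_left_pos mult_le_cancel_right1 order_trans mult.commute not_less)
  have "(avg \<pi> g - ?m) * mass \<pi> g = (LINT h|\<pi>. (h - ?m) * g h) - c * (LINT h|\<pi>. (h - ?m) * f h)"
    using centered_moment[OF g, of ?m] centered_moment[OF f, of ?m] by simp
  also have "\<dots> = (LINT h|\<pi>. (h - ?m) * (g h - c * f h))"
    using integrable_poly_mult(4)[OF i(1)] integrable_poly_mult(4)[OF i(2)]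
    by (simp add: right_diff_distrib mult.left_commute)
  finally have "\<bar>avg \<pi> g - ?m\<bar> * mass \<pi> g = \<bar>LINT h|\<pi>. (h - ?m) * (g h - c * f h)\<bar>"
    using gpos by (metis abs_mult abs_of_pos)
  also have "\<dots> \<le> (LINT h|\<pi>. \<bar>(h - ?m) * (g h - c * f h)\<bar>)" by simp
  also have "\<dots> \<le> (LINT h|\<pi>. 2 * H * (c * (K - 1)) * f h)"
  proof (rule integral_mono)
    show "integrable \<pi> (\<lambda>h. \<bar>(h - ?m) * (g h - c * f h)\<bar>)"
      using i by (intro integrable_abs integrable_poly_mult) auto
    show "integrable \<pi> (\<lambda>h. 2 * H * (c * (K - 1)) * f h)" using i by simp
    show "\<bar>(h - ?m) * (g h - c * f h)\<bar> \<le> 2 * H * (c * (K - 1)) * f h" if "h \<in> space \<pi>" for h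
    proof -
      have "\<bar>h - ?m\<bar> * \<bar>g h - c * f h\<bar> \<le> 2 * H * (c * (K - 1) * f h)"
        using that sw[of h] dev_bound[OF f, of h] H_pos
        by (intro mult_mono) (auto simp: space_\<pi> algebra_simps)
      then show ?thesis by (simp add: abs_mult mult.assoc)
    qed
  qed
  also have "\<dots> = 2 * H * (K - 1) * (c * mass \<pi> f)" by (simp add: mass_def)
  also have "\<dots> \<le> 2 * H * (K - 1) * mass \<pi> g" using cm K H_pos by (intro mult_left_mono) auto
  finally show ?thesis using gpos by simp
qed

text \<open>The expansion of the tilted average: the two leading terms of
  \<open>(h - m - \<alpha> W) exp (x h)\<close> integrate to zero against \<open>f\<close>, where \<open>m\<close> and \<open>W\<close> are the mean
  and the variance of the normalised weight.\<close>

lemma avg_tilt_expansion: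
  assumes f: "weight f" and pos: "0 < mass \<pi> f" and k: "0 < k" and w: "0 \<le> w"
    and x: "x \<in> borel_measurable \<pi>" "\<And>h. h \<in> {-H..H} \<Longrightarrow> \<bar>x h - \<alpha> * h\<bar> \<le> w"
    and c: "\<bar>\<alpha>\<bar> * H + 2 * w \<le> c"
  shows "\<bar>avg \<pi> (\<lambda>h. k * (exp (x h) * f h)) - avg \<pi> f - \<alpha> * (spread \<pi> f / mass \<pi> f)\<bar>
    \<le> edge_const c * (H * (\<alpha>\<^sup>2 * H\<^sup>2 + w))"
proof -
  define m where "m = avg \<pi> f"
  define W where "W = spread \<pi> f / mass \<pi> f"
  define g where "g = (\<lambda>h. exp (x h) * f h)"
  define s where "s = \<bar>\<alpha>\<bar> * H"
  define B where "B = \<alpha>\<^sup>2 * H\<^sup>2 + w"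
  define D where "D = (2 + (5 + 3 * c) * exp c) * (H * B)"
  have s0: "0 \<le> s" and c0: "0 \<le> c" and sc: "s + w \<le> c" and wc: "2 * w \<le> c"
    using H_pos w c by (auto simp: s_def intro: order_trans[rotated])
  have B: "B = s\<^sup>2 + w" "0 \<le> B" using w by (simp_all add: B_def s_def power_mult_distrib)
  have W: "0 \<le> W" "W \<le> H\<^sup>2"
    using pos spread_nonneg[OF f] spread_le_mass[OF f] by (auto simp: W_def field_simps)
  have xb: "\<bar>x h\<bar> \<le> s + w" if "h \<in> {-H..H}" for h
  proof -
    have "\<bar>\<alpha> * h\<bar> \<le> s" using that unfolding abs_mult s_def by (intro mult_left_mono) auto
    with x(2)[OF that] show ?thesis by linarith
  qed
  have xc: "\<bar>x h\<bar> \<le> c" if "h \<in> {-H..H}" for h using xb[OF that] sc by linarith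
  note i = weightD(1)[OF f]
  have gi: "integrable \<pi> g"
    unfolding g_def using x(1) xc by (intro integrable_bounded_mult[OF i, of _ "exp c"]) (auto simp: abs_le_iff)
  have g: "weight g" using gi weightD(2)[OF f] by (auto simp: weight_def g_def)
  have gmass: "exp (- c) * mass \<pi> f \<le> mass \<pi> g"
    unfolding mass_def integral_mult_right_zero[symmetric] g_def
  proof (rule integral_mono)
    show "exp (- c) * f h \<le> exp (x h) * f h" if "h \<in> space \<pi>" for h
      using that xc[of h] weightD(2)[OF f, of h] by (intro mult_right_mono) (auto simp: space_\<pi>)
  qed (use i gi in \<open>auto simp: g_def\<close>)
  then have gpos: "0 < mass \<pi> g" using pos by (meson exp_gt_zero less_le_trans mult_pos_pos)
  \<comment> \<open>What is left of (h - m - \<alpha> W) exp (x h) after (h - m) + \<alpha> ((h - m)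
    h - W) is removed. Against \<open>f\<close> the first removed part has integral zero, and so has
    the second, by the definition of W.\<close>
  define r where "r h = (h - m) * (exp (x h) - 1 - \<alpha> * h) - \<alpha> * W * (exp (x h) - 1)" for h
  have rb: "\<bar>r h\<bar> \<le> D" if h: "h \<in> {-H..H}" for h
  proof -
    have e: "exp \<bar>x h\<bar> \<le> exp c" using xc[OF h] by simp
    have wB: "w \<le> B" using B by simp
    have "(x h)\<^sup>2 \<le> (s + w)\<^sup>2" using xb[OF h] by (intro power2_le_iff_abs_le[THEN iffD2]) (use s0 w in auto)
    also have "\<dots> \<le> 2 * s\<^sup>2 + 2 * (w * w)"
      using sum_squares_bound[of s w] by (simp add: power2_eq_square algebra_simps)
    \<comment> \<open>The bound on 2 w makes the quadratic term linear in \<open>w\<close>; this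
      keeps the remainder of order B = s^2 + w.\<close>
    also have "\<dots> \<le> 2 * s\<^sup>2 + c * w" using wc w mult_right_mono[of "2 * w" c w] by simp
    also have "\<dots> \<le> (2 + c) * B" using c0 w B by (simp add: algebra_simps)
    finally have x2: "(x h)\<^sup>2 \<le> (2 + c) * B" .
    have "\<bar>exp (x h) - 1 - x h\<bar> \<le> (2 + c) * B * exp c"
      using abs_exp_minus_one_minus_le[of "x h"] mult_mono[OF x2 e] B c0 by force
    then have t1: "\<bar>exp (x h) - 1 - \<alpha> * h\<bar> \<le> (2 + c) * B * exp c + B"
      using x(2)[OF h] wB by linarith
    have "\<bar>exp (x h) - 1\<bar> \<le> (s + w) * exp c"
      using abs_exp_minus_one_le[of "x h"] mult_mono[OF xb[OF h] e] s0 w by force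
    moreover have "\<bar>\<alpha> * W\<bar> \<le> s * H"
    proof -
      have "\<bar>\<alpha>\<bar> * \<bar>W\<bar> \<le> \<bar>\<alpha>\<bar> * H\<^sup>2" using W by (intro mult_left_mono) auto
      then show ?thesis by (simp add: abs_mult s_def power2_eq_square)
    qed
    ultimately have "\<bar>\<alpha> * W\<bar> * \<bar>exp (x h) - 1\<bar> \<le> (s * H) * ((s + w) * exp c)"
      using s0 H_pos by (intro mult_mono) auto
    also have "\<dots> = H * exp c * (s\<^sup>2 + s * w)" by (simp add: algebra_simps power2_eq_square)
    also have "\<dots> \<le> H * exp c * (s\<^sup>2 + c * w)"
      using H_pos sc w by (intro mult_left_mono add_left_mono mult_right_mono) auto
    also have "\<dots> \<le> H * exp c * ((1 + c) * B)"
      using H_pos c0 w B(1) by (intro mult_left_mono) (auto simp: algebra_simps)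
    finally have t2: "\<bar>\<alpha> * W * (exp (x h) - 1)\<bar> \<le> H * exp c * ((1 + c) * B)" by (simp add: abs_mult)
    have t3: "\<bar>(h - m) * (exp (x h) - 1 - \<alpha> * h)\<bar> \<le> 2 * H * ((2 + c) * B * exp c + B)"
      unfolding abs_mult using dev_bound[OF f h] t1 H_pos by (intro mult_mono) (auto simp: m_def)
    have "\<bar>r h\<bar> \<le> 2 * H * ((2 + c) * B * exp c + B) + H * exp c * ((1 + c) * B)"
      unfolding r_def using t2 t3 by linarith
    also have "\<dots> = D" by (simp add: D_def algebra_simps)
    finally show ?thesis .
  qed
  have rm: "r \<in> borel_measurable \<pi>" unfolding r_def using x(1) by measurable
  have ri: "integrable \<pi> (\<lambda>h. r h * f h)" by (rule integrable_bounded_mult[OF i rm rb])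
  have "(avg \<pi> g - (m + \<alpha> * W)) * mass \<pi> g = (LINT h|\<pi>. (h - (m + \<alpha> * W)) * g h)"
    using centered_moment[OF g] by simp
  also have "\<dots> = (LINT h|\<pi>. ((h - m) * f h + \<alpha> * ((h - m) * h * f h) - \<alpha> * W * f h) + r h * f h)"
    by (intro Bochner_Integration.integral_cong) (auto simp: g_def r_def algebra_simps)
  also have "\<dots> = (LINT h|\<pi>. r h * f h)"
  proof -
    have i3: "integrable \<pi> (\<lambda>h. (h - m) * h * f h)"
      using integrable_poly_mult(4)[OF integrable_poly_mult(1)[OF i], of m] by (simp add: mult.assoc)
    have "\<alpha> * spread \<pi> f - \<alpha> * W * mass \<pi> f = 0" using pos by (simp add: W_def)
    then show ?thesis
      using i i3 ri integrable_poly_mult(4)[OF i, of m] centered_moment[OF f, of m]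
        centered_product_moment[OF f] by (simp add: m_def mass_def)
  qed
  finally have "\<bar>avg \<pi> g - (m + \<alpha> * W)\<bar> * mass \<pi> g = \<bar>LINT h|\<pi>. r h * f h\<bar>"
    using gpos by (metis abs_mult abs_of_pos)
  also have "\<dots> \<le> (LINT h|\<pi>. \<bar>r h * f h\<bar>)" by simp
  also have "\<dots> \<le> (LINT h|\<pi>. D * f h)"
  proof (rule integral_mono)
    show "\<bar>r h * f h\<bar> \<le> D * f h" if "h \<in> space \<pi>" for h
      using that rb[of h] weightD(2)[OF f, of h] by (auto simp: space_\<pi> abs_mult intro!: mult_right_mono)
  qed (use ri i in \<open>auto intro: integrable_abs\<close>)
  also have "\<dots> = exp c * D * (exp (- c) * mass \<pi> f)" by (simp add: mass_def exp_minus)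
  also have "\<dots> \<le> exp c * D * mass \<pi> g"
    using gmass c0 H_pos B(2) by (intro mult_left_mono) (auto simp: D_def)
  finally have "\<bar>avg \<pi> g - (m + \<alpha> * W)\<bar> \<le> exp c * D" using gpos by simp
  moreover have "avg \<pi> (\<lambda>h. k * (exp (x h) * f h)) = avg \<pi> g"
    using avg_cmult[of k \<pi> g] k by (simp add: g_def)
  ultimately show ?thesis
    by (simp add: m_def W_def D_def edge_const_def B_def algebra_simps)
qed

text \<open>With d = \<alpha> W + R, the difference of squares is 2 \<alpha> W R + R^2. Since W is
  at most H^2 and R is of order H B, the cross term and the square give exactly the two summands in
  the bracket of \<open>Xi\<close>.\<close>

lemma avg_tilt_square:
  assumes f: "weight f" and pos: "0 < mass \<pi> f" and k: "0 < k" and w: "0 \<le> w"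
    and x: "x \<in> borel_measurable \<pi>" "\<And>h. h \<in> {-H..H} \<Longrightarrow> \<bar>x h - \<alpha> * h\<bar> \<le> w"
    and c: "\<bar>\<alpha>\<bar> * H + 2 * w \<le> c"
  defines "B \<equiv> \<alpha>\<^sup>2 * H\<^sup>2 + w"
  shows "\<bar>(avg \<pi> (\<lambda>h. k * (exp (x h) * f h)) - avg \<pi> f)\<^sup>2 - \<alpha>\<^sup>2 * (spread \<pi> f / mass \<pi> f)\<^sup>2\<bar>
    \<le> (2 * edge_const c + (edge_const c)\<^sup>2) * (\<bar>\<alpha>\<bar> * H ^ 3 * B + H\<^sup>2 * B\<^sup>2)"
proof -
  define d where "d = avg \<pi> (\<lambda>h. k * (exp (x h) * f h)) - avg \<pi> f"
  define W where "W = spread \<pi> f / mass \<pi> f"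
  let ?C = "edge_const c"
  have "0 \<le> \<bar>\<alpha>\<bar> * H" using H_pos by simp
  then have C0: "0 \<le> ?C" using c w by (intro edge_const_nonneg) linarith
  have B0: "0 \<le> B" using w by (simp add: B_def)
  have W: "0 \<le> W" "W \<le> H\<^sup>2"
    using pos spread_nonneg[OF f] spread_le_mass[OF f] by (auto simp: W_def field_simps)
  have R: "\<bar>d - \<alpha> * W\<bar> \<le> ?C * (H * B)"
    using avg_tilt_expansion[OF f pos k w x c] unfolding d_def W_def B_def by simp
  have "d\<^sup>2 - \<alpha>\<^sup>2 * W\<^sup>2 = 2 * (\<alpha> * W) * (d - \<alpha> * W) + (d - \<alpha> * W)\<^sup>2"
    by (simp add: power2_eq_square algebra_simps)
  then have "\<bar>d\<^sup>2 - \<alpha>\<^sup>2 * W\<^sup>2\<bar> \<le> \<bar>2 * (\<alpha> * W) * (d - \<alpha> * W)\<bar> + (d - \<alpha> * W)\<^sup>2"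
    using abs_triangle_ineq[of "2 * (\<alpha> * W) * (d - \<alpha> * W)" "(d - \<alpha> * W)\<^sup>2"] by simp
  also have "\<dots> = 2 * (\<bar>\<alpha>\<bar> * W) * \<bar>d - \<alpha> * W\<bar> + \<bar>d - \<alpha> * W\<bar>\<^sup>2"
    using W by (simp add: abs_mult)
  also have "\<dots> \<le> 2 * (\<bar>\<alpha>\<bar> * H\<^sup>2) * (?C * (H * B)) + (?C * (H * B))\<^sup>2"
    using R W by (intro add_mono mult_mono power_mono) (auto intro: mult_left_mono)
  also have "\<dots> = 2 * ?C * (\<bar>\<alpha>\<bar> * H ^ 3 * B) + ?C\<^sup>2 * (H\<^sup>2 * B\<^sup>2)"
    by (simp add: power2_eq_square power3_eq_cube algebra_simps)
  also have "\<dots> \<le> (2 * ?C + ?C\<^sup>2) * (\<bar>\<alpha>\<bar> * H ^ 3 * B) + (2 * ?C + ?C\<^sup>2) * (H\<^sup>2 * B\<^sup>2)"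
    using C0 B0 H_pos by (intro add_mono mult_right_mono) auto
  finally show ?thesis unfolding d_def W_def by (simp add: algebra_simps)
qed

end

section \<open>Gaussian reference\<close>

lemma gauss_nonneg: "0 \<le> gauss v h y"
  by (simp add: gauss_def)

lemma gauss_pos: "0 < v \<Longrightarrow> 0 < gauss v h y"
  by (simp add: gauss_def normal_density_pos)

lemma gauss_eq: "0 < v \<Longrightarrow> gauss v h y = exp (- (y - h)\<^sup>2 / (2 * v)) / sqrt (2 * pi * v)"
  by (simp add: gauss_def normal_density_def)

lemma gauss_le: "0 < v \<Longrightarrow> gauss v h y \<le> 1 / sqrt (2 * pi * v)"
  unfolding gauss_eq by (intro divide_right_mono) auto

lemma gauss_measurable [measurable]: "(\<lambda>x. gauss v (f x) (g x)) \<in> borel_measurable M"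
  if [measurable]: "f \<in> borel_measurable M" "g \<in> borel_measurable M"
  unfolding gauss_def by measurable

lemma nn_integral_gauss: "0 < v \<Longrightarrow> (\<integral>\<^sup>+y. ennreal (gauss v h y) \<partial>lborel) = 1"
proof -
  assume "0 < v"
  then have s: "0 < sqrt v" by simp
  have "gauss v h y = normal_density h (sqrt v) y" for y by (simp add: gauss_def normal_density_def)
  then show ?thesis using nn_integral_eq_integral[OF integrable_normal_density[OF s, of h]]
      integral_normal_density[OF s, of h] by (simp add: normal_density_nonneg)
qed

section \<open>Total variation of the Gaussian density\<close>

lemma gauss_has_derivative:
  assumes "0 < v"
  shows "((\<lambda>y. gauss v h y) has_real_derivative - ((y - h) / v * gauss v h y)) (at y)"
proof -
  have "((\<lambda>y. - (y - h)\<^sup>2 / (2 * v)) has_real_derivative - ((y - h) / v)) (at y)"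
    by (rule derivative_eq_intros refl)+ (use assms in \<open>auto simp: field_simps\<close>)
  from DERIV_cdivide[OF DERIV_fun_exp[OF this], of "sqrt (2 * pi * v)"]
  show ?thesis unfolding gauss_eq[OF assms] by (simp add: mult.commute)
qed

text \<open>The absolute value of the derivative of the density in \<open>y\<close>.\<close>

definition gauss_slope :: "real \<Rightarrow> real \<Rightarrow> real \<Rightarrow> real" where
  "gauss_slope v h y = \<bar>y - h\<bar> / v * gauss v h y"

lemma gauss_slope_measurable [measurable]: "gauss_slope v h \<in> borel_measurable borel"
  unfolding gauss_slope_def by measurable

text \<open>The first absolute central moment of the normal law, divided by v. The value is twice
  the peak height of the density, as expected of the total variation of a unimodal function.\<close>

lemma nn_integral_gauss_slope:
  assumes "0 < v"
  shows "(\<integral>\<^sup>+y. ennreal (gauss_slope v h y) \<partial>lborel) = ennreal (sqrt (2 / (pi * v)))"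
proof -
  have "has_bochner_integral lborel (\<lambda>y. normal_density h (sqrt v) y * \<bar>y - h\<bar>) (sqrt v * sqrt (2 / pi))"
    using normal_moment_abs_odd[of "sqrt v" h 0] assms by simp
  then have "has_bochner_integral lborel (\<lambda>y. normal_density h (sqrt v) y * \<bar>y - h\<bar> / v)
      (sqrt v * sqrt (2 / pi) / v)"
    by (rule has_bochner_integral_divide)
  moreover have "sqrt v * sqrt (2 / pi) / v = sqrt (2 / (pi * v))"
  proof -
    have "sqrt v * sqrt (2 / pi) / v = sqrt (2 / pi) * (sqrt v / v)" by simp
    also have "sqrt v / v = 1 / sqrt v" using assms by (simp add: sqrt_divide_self_eq inverse_eq_divide)
    also have "sqrt (2 / pi) * (1 / sqrt v) = sqrt (2 / (pi * v))"
      by (simp only: times_divide_eq_right mult_1_right real_sqrt_divide[symmetric] divide_divide_eq_left)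
    finally show ?thesis .
  qed
  moreover have "normal_density h (sqrt v) y * \<bar>y - h\<bar> / v = gauss_slope v h y" for y
    by (simp add: gauss_slope_def gauss_def normal_density_def mult.commute)
  ultimately have b: "has_bochner_integral lborel (gauss_slope v h) (sqrt (2 / (pi * v)))" by simp
  then show ?thesis
    using nn_integral_eq_integral[of lborel "gauss_slope v h"] assms
    by (auto simp: has_bochner_integral_iff gauss_slope_def gauss_nonneg)
qed

text \<open>Only the open segment has to lie in \<open>A\<close>, because an embedded point is known
  to lie in the closure of its cell while integration runs over the interior. The endpoints are
  null.\<close>

lemma gauss_diff_le:
  assumes "0 < v" "open_segment s t \<subseteq> A" and A: "A \<in> sets borel"
  shows "ennreal \<bar>gauss v h s - gauss v h t\<bar> \<le> (\<integral>\<^sup>+y. ennreal (gauss_slope v h y) * indicator A y \<partial>lborel)"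
proof -
  have wlog: "ennreal \<bar>gauss v h t - gauss v h s\<bar> \<le> (\<integral>\<^sup>+y. ennreal (gauss_slope v h y) * indicator A y \<partial>lborel)"
    if st: "s \<le> t" "{s<..<t} \<subseteq> A" for s t
  proof -
    let ?f = "\<lambda>y. - ((y - h) / v * gauss v h y)"
    have c: "continuous_on {s..t} ?f"
      by (intro continuous_at_imp_continuous_on ballI continuous_intros DERIV_isCont[OF gauss_has_derivative[OF assms(1)]])
        (use assms in auto)
    have ftc: "(LINT y|lborel. indicator {s..t} y *\<^sub>R ?f y) = gauss v h t - gauss v h s"
      by (rule integral_FTC_atLeastAtMost[OF st(1) _ c])
        (rule has_field_derivative_at_within[OF gauss_has_derivative[OF assms(1)],
            unfolded has_real_derivative_iff_has_vector_derivative])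
    have "ennreal \<bar>gauss v h t - gauss v h s\<bar> = ennreal (norm (LINT y|lborel. indicator {s..t} y *\<^sub>R ?f y))"
      unfolding ftc by simp
    also have "\<dots> \<le> (\<integral>\<^sup>+y. ennreal (norm (indicator {s..t} y *\<^sub>R ?f y)) \<partial>lborel)"
      using borel_integrable_atLeastAtMost'[OF c] 
      by (intro integral_norm_bound_ennreal) (simp add: set_integrable_def)
    also have "\<dots> \<le> (\<integral>\<^sup>+y. ennreal (gauss_slope v h y) * indicator A y \<partial>lborel)"
    proof (rule nn_integral_mono_AE)
      have "AE y in lborel. y \<noteq> s" "AE y in lborel. y \<noteq> t" by (rule AE_lborel_singleton)+
      then show "AE y in lborel. ennreal (norm (indicator {s..t} y *\<^sub>R ?f y)) \<le> ennreal (gauss_slope v h y) * indicator A y"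
      proof eventually_elim
        case (elim y)
        then have "y \<in> {s..t} \<Longrightarrow> y \<in> A" using st(2) by auto
        then show ?case using assms(1)
          by (cases "y \<in> {s..t}") (simp_all add: gauss_slope_def abs_mult gauss_nonneg)
      qed
    qed
    finally show ?thesis .
  qed
  show ?thesis
  proof (cases "s \<le> t")
    case True
    then show ?thesis using wlog[of s t] assms(2)
      by (auto simp: abs_minus_commute open_segment_eq_real_ivl)
  next
    case False
    then show ?thesis using wlog[of t s] assms(2) by (auto simp: open_segment_eq_real_ivl)
  qed
qed

text \<open>Finiteness of one side passes to the other through the second inequality, so neither
  real value is a default.\<close>

lemma enn2real_diff_le:
  assumes "S \<le> J + ennreal b" "J \<le> S + ennreal b" "S < \<infinity>" "0 \<le> b"
  shows "\<bar>enn2real S - enn2real J\<bar> \<le> b"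
proof -
  have "J < \<infinity>" using assms(2,3) by (auto intro: le_less_trans)
  then obtain s j where "S = ennreal s" "0 \<le> s" "J = ennreal j" "0 \<le> j"
    using assms(3) by (metis ennreal_enn2real enn2real_nonneg infinity_ennreal_def)
  then show ?thesis using assms(1,2,4)
    by (auto simp flip: ennreal_plus)
qed

section \<open>Bayes risk and Gaussian energy as integrals of the functionals\<close>

context bounded_prior
begin

text \<open>Once the order of integration is exchanged (\<open>swap\<close>), the estimator can be
  optimised separately at each observation, and the posterior mean attains the minimum. The
  dominating measure is left open to serve both Lebesgue measure and counting measure.\<close>

lemma bayes_risk_eq:
  fixes N :: "'y measure"
  assumes swap: "\<And>\<delta>. \<delta> \<in> borel_measurable N \<Longrightarrow>
      (\<integral>\<^sup>+h. sq_risk M \<delta> h \<partial>\<pi>) = (\<integral>\<^sup>+(y::'y). \<integral>\<^sup>+h. ennreal ((\<delta> y - h)\<^sup>2 * L h y) \<partial>\<pi> \<partial>\<mu>)"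
    and m: "(\<lambda>y. avg \<pi> (\<lambda>h. L h y)) \<in> borel_measurable N"
    and w: "\<And>y. y \<in> space \<mu> \<Longrightarrow> weight (\<lambda>h. L h y)"
  shows "bayes_risk N M \<pi> = (\<integral>\<^sup>+y. ennreal (spread \<pi> (\<lambda>h. L h y)) \<partial>\<mu>)"
proof -
  have inner: "(\<integral>\<^sup>+h. ennreal ((d - h)\<^sup>2 * L h y) \<partial>\<pi>) = ennreal (LINT h|\<pi>. (h - d)\<^sup>2 * L h y)"
    if "y \<in> space \<mu>" for y d
    using integrable_poly_mult(2)[OF weightD(1)[OF w[OF that]], of d] weightD(2)[OF w[OF that]]
    by (subst nn_integral_eq_integral) (auto simp: space_\<pi> power2_commute[of d])
  show ?thesis
    unfolding bayes_risk_def
  proof (intro antisym INF_greatest)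
    show "(INF \<delta>\<in>borel_measurable N. \<integral>\<^sup>+h. sq_risk M \<delta> h \<partial>\<pi>) \<le> (\<integral>\<^sup>+y. ennreal (spread \<pi> (\<lambda>h. L h y)) \<partial>\<mu>)"
      by (rule INF_lower2[OF m], subst swap[OF m])
        (auto simp: inner spread_def intro!: nn_integral_mono)
    fix \<delta> :: "'y \<Rightarrow> real" assume d: "\<delta> \<in> borel_measurable N"
    show "(\<integral>\<^sup>+y. ennreal (spread \<pi> (\<lambda>h. L h y)) \<partial>\<mu>) \<le> (\<integral>\<^sup>+h. sq_risk M \<delta> h \<partial>\<pi>)"
      unfolding swap[OF d] by (intro nn_integral_mono) (auto simp: inner intro!: ennreal_leI spread_le w)
  qed
qed

lemma gauss_weight: "0 < v \<Longrightarrow> weight (\<lambda>h. gauss v h y)"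
proof -
  assume v: "0 < v"
  have "integrable \<pi> (\<lambda>h. gauss v h y)"
    by (rule integrable_const_bound[where B = "1 / sqrt (2 * pi * v)"])
      (use gauss_le[OF v] gauss_nonneg in auto)
  then show ?thesis by (simp add: weight_def gauss_nonneg)
qed

lemma gauss_mass_measurable [measurable]: "(\<lambda>y. mass \<pi> (\<lambda>h. gauss v h y)) \<in> borel_measurable borel"
  unfolding mass_def by measurable

lemma gauss_avg_measurable [measurable]: "(\<lambda>y. avg \<pi> (\<lambda>h. gauss v h y)) \<in> borel_measurable borel"
  unfolding avg_def by measurable

lemma gauss_spread_measurable [measurable]: "(\<lambda>y. spread \<pi> (\<lambda>h. gauss v h y)) \<in> borel_measurable borel"
  unfolding spread_def by measurable

lemma gauss_energy_measurable [measurable]: "(\<lambda>y. energy \<pi> (\<lambda>h. gauss v h y)) \<in> borel_measurable borel"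
  unfolding energy_def by measurable

lemma nn_integral_mass: "weight f \<Longrightarrow> (\<integral>\<^sup>+h. ennreal (f h) \<partial>\<pi>) = ennreal (mass \<pi> f)"
  unfolding mass_def by (rule nn_integral_eq_integral) (auto simp: weight_def space_\<pi>)

lemma prior_swap_lborel:
  fixes f :: "real \<Rightarrow> real \<Rightarrow> ennreal"
  assumes "(\<lambda>(h, y). f h y) \<in> borel_measurable (\<pi> \<Otimes>\<^sub>M lborel)"
  shows "(\<integral>\<^sup>+h. \<integral>\<^sup>+y. f h y \<partial>lborel \<partial>\<pi>) = (\<integral>\<^sup>+y. \<integral>\<^sup>+h. f h y \<partial>\<pi> \<partial>lborel)"
proof -
  interpret pair_sigma_finite \<pi> lborel ..
  show ?thesis using Fubini'[of f] assms by simp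
qed

lemma risk_G_eq:
  assumes v: "0 < v"
  shows "risk_G v \<pi> = enn2real (\<integral>\<^sup>+y. ennreal (spread \<pi> (\<lambda>h. gauss v h y)) \<partial>lborel)"
proof -
  have "bayes_risk borel (gauss_law v) \<pi> = (\<integral>\<^sup>+y. ennreal (spread \<pi> (\<lambda>h. gauss v h y)) \<partial>lborel)"
  proof (rule bayes_risk_eq)
    fix \<delta> :: "real \<Rightarrow> real" assume [measurable]: "\<delta> \<in> borel_measurable borel"
    have "(\<integral>\<^sup>+h. sq_risk (gauss_law v) \<delta> h \<partial>\<pi>) = (\<integral>\<^sup>+h. \<integral>\<^sup>+y. ennreal ((\<delta> y - h)\<^sup>2 * gauss v h y) \<partial>lborel \<partial>\<pi>)"
      unfolding sq_risk_def gauss_law_def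
      by (intro nn_integral_cong) (auto simp: nn_integral_density ennreal_mult' gauss_nonneg mult.commute)
    also have "\<dots> = (\<integral>\<^sup>+y. \<integral>\<^sup>+h. ennreal ((\<delta> y - h)\<^sup>2 * gauss v h y) \<partial>\<pi> \<partial>lborel)"
      using prior_swap_lborel[of "\<lambda>h y. ennreal ((\<delta> y - h)\<^sup>2 * gauss v h y)"] by simp
    finally show "(\<integral>\<^sup>+h. sq_risk (gauss_law v) \<delta> h \<partial>\<pi>) = \<dots>" .
  qed (auto intro: gauss_weight[OF v])
  then show ?thesis by (simp add: risk_G_def)
qed

lemma nn_integral_gauss_mass:
  assumes v: "0 < v"
  shows "(\<integral>\<^sup>+y. ennreal (mass \<pi> (\<lambda>h. gauss v h y)) \<partial>lborel) = 1"
proof -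
  have "(\<integral>\<^sup>+y. ennreal (mass \<pi> (\<lambda>h. gauss v h y)) \<partial>lborel) = (\<integral>\<^sup>+h. \<integral>\<^sup>+y. ennreal (gauss v h y) \<partial>lborel \<partial>\<pi>)"
    using prior_swap_lborel[of "\<lambda>h y. ennreal (gauss v h y)"] by (simp add: nn_integral_mass gauss_weight[OF v])
  then show ?thesis by (simp add: nn_integral_gauss[OF v] emeasure_space_1)
qed

lemma energy_eq: "weight f \<Longrightarrow> energy \<pi> f = mass \<pi> f * (spread \<pi> f / mass \<pi> f)\<^sup>2"
  by (cases "mass \<pi> f = 0") (auto simp: energy_def power2_eq_square)

text \<open>The posterior variance depends on the observation alone, so integrating out the
  parameter first replaces the likelihood by the marginal mass.\<close>

lemma gauss_energy_eq:
  assumes v: "0 < v"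
  shows "gauss_energy v \<pi> = enn2real (\<integral>\<^sup>+y. ennreal (energy \<pi> (\<lambda>h. gauss v h y)) \<partial>lborel) / v\<^sup>2"
proof -
  define W where "W y = (spread \<pi> (\<lambda>h. gauss v h y) / mass \<pi> (\<lambda>h. gauss v h y))\<^sup>2" for y
  have [measurable]: "W \<in> borel_measurable borel" unfolding W_def by measurable
  have W0: "0 \<le> W y" for y by (simp add: W_def)
  \<comment> \<open>Boundedness keeps the inner integrals finite, so that they survive the passage
    to extended nonnegative reals and back. Dividing by the mass is allowed because a Gaussian
    likelihood is positive everywhere.\<close>
  have WH: "W y \<le> H ^ 4" for y
  proof -
    have "energy \<pi> (\<lambda>h. gauss v h y) = mass \<pi> (\<lambda>h. gauss v h y) * W y"
      using energy_eq[OF gauss_weight[OF v]] by (simp add: W_def)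
    moreover have "0 < mass \<pi> (\<lambda>h. gauss v h y)" by (intro mass_pos gauss_weight gauss_pos v)
    ultimately show ?thesis using energy_le_mass[OF gauss_weight[OF v], of y] by (simp add: mult.commute)
  qed
  have inner: "(\<integral>\<^sup>+y. ennreal (W y) \<partial>gauss_law v h) = (\<integral>\<^sup>+y. ennreal (W y * gauss v h y) \<partial>lborel)" for h
    unfolding gauss_law_def by (auto simp: nn_integral_density ennreal_mult' gauss_nonneg W0 mult.commute)
  have "(LINT h|\<pi>. LINT y|gauss_law v h. (post_var \<pi> (gauss v) y / v)\<^sup>2)
      = (LINT h|\<pi>. (LINT y|gauss_law v h. W y) / v\<^sup>2)"
    unfolding post_var_eq_spread W_def power_divide[of _ v] by simp
  also have "\<dots> = (LINT h|\<pi>. LINT y|gauss_law v h. W y) / v\<^sup>2" by simp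
  also have "(LINT h|\<pi>. LINT y|gauss_law v h. W y) = (LINT h|\<pi>. enn2real (\<integral>\<^sup>+y. ennreal (W y * gauss v h y) \<partial>lborel))"
    unfolding inner[symmetric]
    by (intro Bochner_Integration.integral_cong refl integral_eq_nn_integral)
      (auto simp: gauss_law_def W0)
  also have "\<dots> = enn2real (\<integral>\<^sup>+h. \<integral>\<^sup>+y. ennreal (W y * gauss v h y) \<partial>lborel \<partial>\<pi>)"
  proof -
    have fin: "(\<integral>\<^sup>+y. ennreal (W y * gauss v h y) \<partial>lborel) \<le> ennreal (H ^ 4)" for h
    proof -
      have "(\<integral>\<^sup>+y. ennreal (W y * gauss v h y) \<partial>lborel) \<le> (\<integral>\<^sup>+y. ennreal (H ^ 4) * ennreal (gauss v h y) \<partial>lborel)"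
        using WH gauss_nonneg by (intro nn_integral_mono) (auto simp flip: ennreal_mult' intro!: ennreal_leI mult_right_mono)
      then show ?thesis by (simp add: nn_integral_cmult nn_integral_gauss[OF v])
    qed
    then have eq: "ennreal (enn2real (\<integral>\<^sup>+y. ennreal (W y * gauss v h y) \<partial>lborel)) = (\<integral>\<^sup>+y. ennreal (W y * gauss v h y) \<partial>lborel)" for h
      by (intro ennreal_enn2real) (rule le_less_trans[OF fin]; simp)
    show ?thesis by (subst integral_eq_nn_integral) (auto simp: eq)
  qed
  also have "(\<integral>\<^sup>+h. \<integral>\<^sup>+y. ennreal (W y * gauss v h y) \<partial>lborel \<partial>\<pi>) = (\<integral>\<^sup>+y. ennreal (energy \<pi> (\<lambda>h. gauss v h y)) \<partial>lborel)"
  proof -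
    have "(\<integral>\<^sup>+h. ennreal (W y * gauss v h y) \<partial>\<pi>) = ennreal (energy \<pi> (\<lambda>h. gauss v h y))" for y
    proof -
      have "(\<integral>\<^sup>+h. ennreal (W y * gauss v h y) \<partial>\<pi>) = ennreal (W y) * (\<integral>\<^sup>+h. ennreal (gauss v h y) \<partial>\<pi>)"
        by (simp add: ennreal_mult W0 gauss_nonneg nn_integral_cmult)
      also have "\<dots> = ennreal (W y * mass \<pi> (\<lambda>h. gauss v h y))"
        using mass_nonneg[OF gauss_weight[OF v]] by (simp add: nn_integral_mass[OF gauss_weight[OF v]] ennreal_mult W0)
      finally show ?thesis using energy_eq[OF gauss_weight[OF v], of y] by (simp add: W_def mult.commute)
    qed
    then show ?thesis using prior_swap_lborel[of "\<lambda>h y. ennreal (W y * gauss v h y)"] by simp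
  qed
  finally show ?thesis by (simp add: gauss_energy_def)
qed

lemma gauss_energy_le:
  assumes v: "0 < v"
  shows "gauss_energy v \<pi> \<le> H ^ 4 / v\<^sup>2"
proof -
  have "(\<integral>\<^sup>+y. ennreal (energy \<pi> (\<lambda>h. gauss v h y)) \<partial>lborel)
      \<le> (\<integral>\<^sup>+y. ennreal (H ^ 4) * ennreal (mass \<pi> (\<lambda>h. gauss v h y)) \<partial>lborel)"
    using energy_le_mass[OF gauss_weight[OF v]] mass_nonneg[OF gauss_weight[OF v]]
    by (intro nn_integral_mono) (auto simp flip: ennreal_mult' intro!: ennreal_leI)
  also have "\<dots> = ennreal (H ^ 4)" by (simp add: nn_integral_cmult nn_integral_gauss_mass[OF v])
  finally have "enn2real (\<integral>\<^sup>+y. ennreal (energy \<pi> (\<lambda>h. gauss v h y)) \<partial>lborel) \<le> H ^ 4"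
    by (metis enn2real_mono enn2real_ennreal ennreal_less_top infinity_ennreal_def zero_le_even_power even_numeral)
  then show ?thesis unfolding gauss_energy_eq[OF v] by (intro divide_right_mono) auto
qed

end

section \<open>Transfer between sums over states and Gaussian integrals\<close>

text \<open>The frontier of a convex set is negligible. This lets cells be replaced by their
  interiors, which are the sets assumed to be disjoint.\<close>

lemma interval_frontier_null:
  fixes S :: "real set"
  assumes "is_interval S"
  shows "S - interior S \<in> null_sets lborel"
proof -
  have "frontier S \<in> null_sets lebesgue"
    using assms by (simp add: negligible_convex_frontier is_interval_convex flip: negligible_iff_null_sets)
  then have "frontier S \<in> null_sets lborel" by (subst (asm) null_sets_completion_iff) auto
  moreover have "S - interior S \<in> sets lborel" using real_interval_borel_measurable[OF assms] by simp
  moreover have "S - interior S \<subseteq> frontier S" using closure_subset by (auto simp: frontier_def)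
  ultimately show ?thesis by (rule null_sets_subset)
qed

lemma emeasure_interior_interval:
  fixes S :: "real set"
  assumes "is_interval S"
  shows "emeasure lborel (interior S) = emeasure lborel S"
proof (rule emeasure_eq_AE)
  show "AE x in lborel. (x \<in> interior S) = (x \<in> S)"
    using AE_not_in[OF interval_frontier_null[OF assms]]
    by eventually_elim (use interior_subset in auto)
qed (use real_interval_borel_measurable[OF assms] in auto)

lemma emeasure_interval_le_diameter:
  fixes S :: "real set"
  assumes "bounded S"
  shows "emeasure lborel S \<le> ennreal (diameter S)"
proof (cases "S = {}")
  case False
  let ?C = "closure S"
  have b: "bounded ?C" using assms by (rule bounded_closure)
  have bd: "bdd_below ?C" "bdd_above ?C" using b by (auto intro: bounded_imp_bdd_below bounded_imp_bdd_above)
  have "Inf ?C \<in> ?C" "Sup ?C \<in> ?C"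
    using False bd by (auto intro: closed_contains_Inf closed_contains_Sup)
  then have "Sup ?C - Inf ?C \<le> diameter ?C"
    using diameter_bounded_bound[OF b, of "Sup ?C" "Inf ?C"] by (simp add: dist_real_def)
  then have d: "Sup ?C - Inf ?C \<le> diameter S" using assms by (simp add: diameter_closure)
  have "S \<subseteq> {Inf ?C..Sup ?C}"
    using closure_subset[of S] cInf_lower[OF _ bd(1)] cSup_upper[OF _ bd(2)] by (meson atLeastAtMost_iff subset_iff)
  then have "emeasure lborel S \<le> emeasure lborel {Inf ?C..Sup ?C}" by (intro emeasure_mono) auto
  also have "\<dots> = ennreal (Sup ?C - Inf ?C)"
    using False bd by (intro emeasure_lborel_Icc cInf_le_cSup) auto
  also have "\<dots> \<le> ennreal (diameter S)" using d by (rule ennreal_leI)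
  finally show ?thesis .
qed simp

lemma exp_minus_one_le: "0 \<le> x \<Longrightarrow> x \<le> 1 \<Longrightarrow> exp x - 1 \<le> 2 * x" for x :: real
  using exp_bound[of x] power_le_one[of x] mult_left_le[of x x] by (simp add: power2_eq_square)

text \<open>The error is measured relative to \<open>p\<close>, so that the sum over a probability
  vector is at most 2 e. The factor 2 comes from exp e - 1 \<le> 2 e on [0, 1], hence the
  restriction on \<open>e\<close>.\<close>

lemma abs_diff_le_of_abs_ln_ratio:
  fixes p q e :: real
  assumes "0 < p" "0 < q" "\<bar>ln (p / q)\<bar> \<le> e" "e \<le> 1"
  shows "\<bar>p - q\<bar> \<le> 2 * e * p"
proof -
  define x where "x = ln (p / q)"
  have q: "q = p * exp (- x)" using assms(1,2) by (simp add: x_def exp_minus field_simps)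
  have e: "0 \<le> e" "\<bar>x\<bar> \<le> e" using assms(3) by (auto simp: x_def)
  have "exp (- x) \<le> exp e" "exp (- e) \<le> exp (- x)" using e by auto
  moreover have "1 - e \<le> exp (- e)" using exp_ge_add_one_self[of "- e"] by simp
  ultimately have "\<bar>1 - exp (- x)\<bar> \<le> 2 * e"
    using exp_minus_one_le[OF e(1) assms(4)] e(1) by linarith
  then have "p * \<bar>1 - exp (- x)\<bar> \<le> p * (2 * e)" using assms(1) by (intro mult_left_mono) auto
  moreover have "\<bar>p - q\<bar> = p * \<bar>1 - exp (- x)\<bar>"
    using assms(1) abs_mult[of p "1 - exp (- x)"] by (simp add: q right_diff_distrib)
  ultimately show ?thesis by (simp add: mult.commute)
qed

context bounded_prior
begin

text \<open>The properties shared by \<open>spread\<close> and \<open>energy\<close> on which the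
  passage from sums to integrals rests. The mass bound A controls what lies outside the window and
  gives finiteness, B is the Lipschitz constant, and A \<le> B merges both kinds of error.\<close>

definition risk_functional :: "((real \<Rightarrow> real) \<Rightarrow> real) \<Rightarrow> real \<Rightarrow> real \<Rightarrow> bool" where
  "risk_functional F A B \<longleftrightarrow> 0 \<le> A \<and> A \<le> B \<and>
     (\<forall>f. weight f \<longrightarrow> 0 \<le> F f \<and> F f \<le> A * mass \<pi> f) \<and>
     (\<forall>f g. weight f \<longrightarrow> weight g \<longrightarrow> F f - F g \<le> B * (LINT h|\<pi>. \<bar>f h - g h\<bar>)) \<and>
     (\<forall>c f. F (\<lambda>h. c * f h) = c * F f) \<and>
     (\<forall>v. (\<lambda>y. F (\<lambda>h. gauss v h y)) \<in> borel_measurable borel)"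

lemma risk_functional_spread: "risk_functional (spread \<pi>) (H\<^sup>2) (4 * H\<^sup>2)"
  by (simp add: risk_functional_def spread_nonneg spread_le_mass spread_diff1 spread_cmult)

lemma risk_functional_energy: "risk_functional (energy \<pi>) (H ^ 4) (9 * H ^ 4)"
  by (simp add: risk_functional_def energy_nonneg energy_le_mass energy_diff1 energy_cmult)

lemma risk_functional_lipschitz:
  assumes F: "risk_functional F A B" and f: "weight f" and g: "weight g"
  shows "ennreal (F f) \<le> ennreal (F g) + ennreal B * (\<integral>\<^sup>+h. ennreal \<bar>f h - g h\<bar> \<partial>\<pi>)"
proof -
  have i: "integrable \<pi> (\<lambda>h. \<bar>f h - g h\<bar>)" using f g by (simp add: weight_def)
  have "F f \<le> F g + B * (LINT h|\<pi>. \<bar>f h - g h\<bar>)"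
    using F f g by (force simp: risk_functional_def)
  then have "ennreal (F f) \<le> ennreal (F g + B * (LINT h|\<pi>. \<bar>f h - g h\<bar>))" by (rule ennreal_leI)
  also have "\<dots> = ennreal (F g) + ennreal B * (\<integral>\<^sup>+h. ennreal \<bar>f h - g h\<bar> \<partial>\<pi>)"
    using F g by (subst nn_integral_eq_integral[OF i])
      (auto simp: risk_functional_def ennreal_plus ennreal_mult)
  finally show ?thesis .
qed

lemma avg_cong: "(\<And>h. h \<in> {-H..H} \<Longrightarrow> f h = g h) \<Longrightarrow> avg \<pi> f = avg \<pi> g"
  unfolding avg_def mass_def
  by (intro arg_cong2[where f = "(/)"] Bochner_Integration.integral_cong) (auto simp: space_\<pi>)

end

section \<open>One level and one prior: cells, sums and marginals\<close>

locale plg_level = bounded_prior H \<pi> for H \<pi> +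
  fixes K :: "real set" and C0 c0 v \<epsilon> \<tau> \<tau>\<Gamma> \<kappa> \<beta> \<gamma> \<xi> :: real and E :: "'z plg_model"
  assumes v_K: "v \<in> K" and v_pos: "0 < v"
    and lattice: "lattice_experiment K E H"
    and plg1: "PLG1 K C0 E H \<epsilon>"
    and plg2: "PLG2 K C0 E H \<tau> \<tau>\<Gamma>"
    and plg3: "PLG3 K E H \<kappa> \<beta>"
    and plg4: "PLG4 K C0 c0 E H \<gamma> \<xi>"
begin

abbreviation Z where "Z \<equiv> states E"
abbreviation p where "p h z \<equiv> lik E v h z"
abbreviation g where "g h y \<equiv> gauss v h y"
abbreviation t where "t \<equiv> emb E v"
abbreviation a where "a \<equiv> len E v"
abbreviation I where "I z \<equiv> interior (cell E v z)"
abbreviation U where "U \<equiv> \<Union>z\<in>Z. I z"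
abbreviation cr where "cr \<equiv> core C0 E v H"

lemma countable_Z [simp]: "countable Z"
  using lattice by (simp add: lattice_experiment_def)

lemma core_subset: "cr \<subseteq> Z"
  by (auto simp: core_def)

lemma p_nonneg: "0 \<le> p h z"
  by (simp add: lik_def)

lemma p_measurable [measurable]: "z \<in> Z \<Longrightarrow> (\<lambda>h. p h z) \<in> borel_measurable \<pi>"
  using lattice v_K by (intro measurable_\<pi>) (simp add: lattice_experiment_def)

lemma p_weight: "z \<in> Z \<Longrightarrow> weight (\<lambda>h. p h z)"
  unfolding weight_def
  using p_measurable[of z]
  by (intro conjI integrable_const_bound[where B = 1]) (auto simp: lik_def pmf_le_1)

lemma cells:
  assumes "z \<in> Z"
  shows "is_interval (cell E v z)" "bounded (cell E v z)" "t z \<in> closure (cell E v z)"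
  using lattice v_K assms by (auto simp: lattice_experiment_def quadrature_cells_def)

lemma a_nonneg: "0 \<le> a z"
  by (simp add: len_def)

lemma emeasure_I: "z \<in> Z \<Longrightarrow> emeasure lborel (I z) = ennreal (a z)"
proof -
  assume z: "z \<in> Z"
  have "emeasure lborel (cell E v z) < top"
    by (rule le_less_trans[OF emeasure_interval_le_diameter[OF cells(2)[OF z]]]) simp
  then show ?thesis using emeasure_interior_interval[OF cells(1)[OF z]]
    by (simp add: len_def measure_def)
qed

lemma a_le: "z \<in> Z \<Longrightarrow> ennreal (a z) \<le> ennreal \<kappa>"
proof -
  assume z: "z \<in> Z"
  have "diameter (cell E v z) \<le> \<kappa>" using plg3 v_K z by (auto simp: PLG3_def)
  then show ?thesis
    using emeasure_interval_le_diameter[OF cells(2)[OF z]] emeasure_interior_interval[OF cells(1)[OF z]]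
      emeasure_I[OF z] by (metis ennreal_leI order_trans)
qed

lemma disjoint_I: "disjoint_family_on I Z"
  using lattice v_K by (auto simp: lattice_experiment_def quadrature_cells_def)

lemma window_borel: "window E v \<in> sets borel"
  using lattice v_K by (intro real_interval_borel_measurable) (auto simp: lattice_experiment_def quadrature_cells_def)

lemma cells_measurable [measurable]: "I z \<in> sets borel" "U \<in> sets borel" "- U \<in> sets borel"
proof -
  show "I z \<in> sets borel" by (rule borel_open) simp
  show U: "U \<in> sets borel" by (intro borel_open open_UN) auto
  show "- U \<in> sets borel" by (rule borel_comp[OF U])
qed

text \<open>Passing from cells to interiors loses countably many null sets, since there are
  countably many states.\<close>

lemma AE_U_window: "AE y in lborel. y \<in> U \<longleftrightarrow> y \<in> window E v"
proof -
  have "(\<Union>z\<in>Z. cell E v z - I z) \<in> null_sets lborel"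
    by (intro null_sets_UN' interval_frontier_null cells) auto
  moreover have "sym_diff (\<Union>z\<in>Z. cell E v z) (window E v) \<in> null_sets lborel"
    using lattice v_K by (auto simp: lattice_experiment_def quadrature_cells_def)
  ultimately have "AE y in lborel. y \<notin> (\<Union>z\<in>Z. cell E v z - I z)"
      "AE y in lborel. y \<notin> sym_diff (\<Union>z\<in>Z. cell E v z) (window E v)"
    using AE_not_in by blast+
  then show ?thesis
  proof eventually_elim
    case (elim y)
    then show ?case using interior_subset[of "cell E v _"] by blast
  qed
qed

lemma nn_integral_law:
  assumes "h \<in> {-H..H}"
  shows "(\<integral>\<^sup>+z. f z \<partial>law_E E v h) = (\<integral>\<^sup>+z. ennreal (p h z) * f z \<partial>count_space Z)"
proof -
  have "set_pmf (law E v h) \<subseteq> Z" using lattice v_K assms by (auto simp: lattice_experiment_def)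
  then have "p h z = p h z * indicator Z z" for z
    by (cases "z \<in> Z") (auto simp: lik_def set_pmf_iff)
  then have "ennreal (p h z) * f z = ennreal (p h z) * f z * indicator Z z" for z
    by (metis (no_types, lifting) indicator_simps(1) indicator_simps(2) mult.right_neutral mult_zero_right ennreal_0 mult_zero_left)
  then show ?thesis
    by (simp add: law_E_def nn_integral_measure_pmf nn_integral_count_space_indicator flip: lik_def)
qed

lemma nn_integral_p: "h \<in> {-H..H} \<Longrightarrow> (\<integral>\<^sup>+z. ennreal (p h z) \<partial>count_space Z) = 1"
  using nn_integral_law[of h "\<lambda>_. 1"] by (simp add: law_E_def measure_pmf.emeasure_space_1)

lemma prior_swap_Z:
  "(\<And>z. z \<in> Z \<Longrightarrow> (\<lambda>h. f h z) \<in> borel_measurable \<pi>) \<Longrightarrow>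
   (\<integral>\<^sup>+h. \<integral>\<^sup>+z. f h z \<partial>count_space Z \<partial>\<pi>) = (\<integral>\<^sup>+z. \<integral>\<^sup>+h. f h z \<partial>\<pi> \<partial>count_space Z)"
  by (rule nn_integral_count_space_nn_integral) auto

text \<open>The marginal law of the observation has masses
  \<open>mass \<pi> (\<lambda>h. p h z)\<close>.\<close>

lemma nn_integral_prior_law:
  "(\<integral>\<^sup>+h. \<integral>\<^sup>+z. f z \<partial>law_E E v h \<partial>\<pi>) = (\<integral>\<^sup>+z. ennreal (mass \<pi> (\<lambda>h. p h z)) * f z \<partial>count_space Z)"
proof -
  have "(\<integral>\<^sup>+h. \<integral>\<^sup>+z. f z \<partial>law_E E v h \<partial>\<pi>) = (\<integral>\<^sup>+h. \<integral>\<^sup>+z. ennreal (p h z) * f z \<partial>count_space Z \<partial>\<pi>)"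
    by (intro nn_integral_cong nn_integral_law) (simp add: space_\<pi>)
  also have "\<dots> = (\<integral>\<^sup>+z. \<integral>\<^sup>+h. ennreal (p h z) * f z \<partial>\<pi> \<partial>count_space Z)"
    by (rule prior_swap_Z) measurable
  also have "\<dots> = (\<integral>\<^sup>+z. ennreal (mass \<pi> (\<lambda>h. p h z)) * f z \<partial>count_space Z)"
    by (intro nn_integral_cong) (simp add: nn_integral_multc nn_integral_mass p_weight)
  finally show ?thesis .
qed

lemma nn_integral_p_mass: "(\<integral>\<^sup>+z. ennreal (mass \<pi> (\<lambda>h. p h z)) \<partial>count_space Z) = 1"
proof -
  have "(\<integral>\<^sup>+h. \<integral>\<^sup>+z. 1 \<partial>law_E E v h \<partial>\<pi>) = 1"
    by (simp add: law_E_def measure_pmf.emeasure_space_1 emeasure_space_1)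
  then show ?thesis using nn_integral_prior_law[of "\<lambda>_. 1"] by simp
qed

lemma risk_E_eq: "risk_E E v \<pi> = enn2real (\<integral>\<^sup>+z. ennreal (spread \<pi> (\<lambda>h. p h z)) \<partial>count_space Z)"
proof -
  have "bayes_risk (count_space UNIV) (law_E E v) \<pi> = (\<integral>\<^sup>+z. ennreal (spread \<pi> (\<lambda>h. p h z)) \<partial>count_space Z)"
  proof (rule bayes_risk_eq)
    fix \<delta> :: "'z \<Rightarrow> real"
    have "(\<integral>\<^sup>+h. sq_risk (law_E E v) \<delta> h \<partial>\<pi>) = (\<integral>\<^sup>+h. \<integral>\<^sup>+z. ennreal ((\<delta> z - h)\<^sup>2 * p h z) \<partial>count_space Z \<partial>\<pi>)"
      unfolding sq_risk_def
      by (intro nn_integral_cong) (simp add: nn_integral_law space_\<pi> ennreal_mult' p_nonneg mult.commute)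
    also have "\<dots> = (\<integral>\<^sup>+z. \<integral>\<^sup>+h. ennreal ((\<delta> z - h)\<^sup>2 * p h z) \<partial>\<pi> \<partial>count_space Z)"
      by (rule prior_swap_Z) measurable
    finally show "(\<integral>\<^sup>+h. sq_risk (law_E E v) \<delta> h \<partial>\<pi>) = \<dots>" .
  qed (auto intro: p_weight)
  then show ?thesis by (simp add: risk_E_def)
qed

section \<open>Errors of the discretisation, for each parameter separately\<close>

lemma plg2_core:
  assumes h: "h \<in> {-H..H}"
  shows "emeasure (law_E E v h) (- cr) + (\<integral>\<^sup>+z. ennreal (a z * g h (t z)) \<partial>count_space (Z - cr)) \<le> ennreal \<tau>"
    and "emeasure (law_E E v h) (- cr) \<le> ennreal \<tau>"
proof -
  let ?A = "\<lambda>h. emeasure (law_E E v h) (- cr)" and ?B = "\<lambda>h. emeasure (gauss_law v h) {y. C0 * H < \<bar>y\<bar>}"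
    and ?D = "\<lambda>h. \<integral>\<^sup>+z. ennreal (a z * g h (t z)) \<partial>count_space (Z - cr)"
  have "?A h + ?D h \<le> (SUP h\<in>{-H..H}. ?A h) + (SUP h\<in>{-H..H}. ?D h)"
    using h by (intro add_mono SUP_upper)
  also have "\<dots> \<le> (SUP h\<in>{-H..H}. ?A h) + (SUP h\<in>{-H..H}. ?B h) + (SUP h\<in>{-H..H}. ?D h)"
    by (intro add_mono) auto
  also have "\<dots> \<le> ennreal \<tau>" using plg2 v_K by (auto simp: PLG2_def)
  finally show *: "?A h + ?D h \<le> ennreal \<tau>" .
  have "?A h \<le> ?A h + ?D h" by simp
  with * show "?A h \<le> ennreal \<tau>" by (rule order_trans[rotated])
qed

text \<open>The signs of \<beta> and \<kappa> are forced: \<beta> dominates a Gaussian probability,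
  and \<kappa> the diameter of the cell of some state in the support of the law at parameter
  0.\<close>

lemma error_ranges: "0 \<le> \<epsilon>" "\<epsilon> \<le> 1" "0 \<le> \<tau>" "0 \<le> \<tau>\<Gamma>" "0 \<le> \<gamma>" "0 \<le> \<xi>" "0 \<le> \<beta>" "0 \<le> \<kappa>"
proof -
  show "0 \<le> \<epsilon>" "\<epsilon> \<le> 1" "0 \<le> \<tau>" "0 \<le> \<tau>\<Gamma>" "0 \<le> \<gamma>" "0 \<le> \<xi>"
    using plg1 plg2 plg4 by (auto simp: PLG1_def PLG2_def PLG4_def)
  have H0: "0 \<in> {-H..H}" using H_pos by simp
  have "measure (gauss_law v 0) (- window E v) \<le> \<beta>" using plg3 v_K H0 unfolding PLG3_def by blast
  then show "0 \<le> \<beta>" using measure_nonneg[of "gauss_law v 0" "- window E v"] by linarith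
  obtain z where "z \<in> set_pmf (law E v 0)" using set_pmf_not_empty by fast
  then have z: "z \<in> Z" using lattice v_K H0 unfolding lattice_experiment_def by blast
  then show "0 \<le> \<kappa>" using plg3 v_K diameter_ge_0[OF cells(2)[OF z]] by (force simp: PLG3_def)
qed

lemma core_density:
  assumes h: "h \<in> {-H..H}" and z: "z \<in> cr"
  shows "0 < p h z" "\<bar>p h z - a z * g h (t z)\<bar> \<le> 2 * \<epsilon> * p h z"
proof -
  have *: "0 < a z" "0 < p h z" "\<bar>ln (p h z / (a z * g h (t z)))\<bar> \<le> \<epsilon>"
    using plg1 v_K h z by (auto simp: PLG1_def)
  then show "0 < p h z" "\<bar>p h z - a z * g h (t z)\<bar> \<le> 2 * \<epsilon> * p h z"
    using gauss_pos[OF v_pos] error_ranges(2) by (auto intro!: abs_diff_le_of_abs_ln_ratio)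
qed

text \<open>On the core the error is relative to the masses, which sum to at most one. Off the core
  the triangle inequality leaves the tail of the law and the tail of the Gaussian sum, both covered
  by the same \<tau>.\<close>

lemma density_error:
  assumes h: "h \<in> {-H..H}"
  shows "(\<integral>\<^sup>+z. ennreal \<bar>p h z - a z * g h (t z)\<bar> \<partial>count_space Z) \<le> ennreal (2 * \<epsilon> + \<tau>)"
proof -
  have pw: "ennreal \<bar>p h z - a z * g h (t z)\<bar> \<le> ennreal (2 * \<epsilon>) * ennreal (p h z)
     + (ennreal (p h z) * indicator (- cr) z + ennreal (a z * g h (t z)) * indicator (- cr) z)"
    if "z \<in> Z" for z
  proof (cases "z \<in> cr")
    case True
    then show ?thesis using core_density[OF h] error_ranges
      by (auto simp flip: ennreal_mult simp: p_nonneg intro!: ennreal_leI)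
  next
    case False
    have "\<bar>p h z - a z * g h (t z)\<bar> \<le> p h z + a z * g h (t z)"
      using p_nonneg[of h z] a_nonneg[of z] gauss_nonneg[of v h "t z"] mult_nonneg_nonneg
      by (intro abs_leI) (auto simp: add_increasing)
    then have "ennreal \<bar>p h z - a z * g h (t z)\<bar> \<le> ennreal (p h z) + ennreal (a z * g h (t z))"
      using p_nonneg[of h z] a_nonneg[of z] gauss_nonneg[of v h "t z"]
      by (simp add: ennreal_leI flip: ennreal_plus)
    then show ?thesis using False by (simp add: add_increasing)
  qed
  have "(\<integral>\<^sup>+z. ennreal \<bar>p h z - a z * g h (t z)\<bar> \<partial>count_space Z) \<le>
    (\<integral>\<^sup>+z. ennreal (2 * \<epsilon>) * ennreal (p h z)
     + (ennreal (p h z) * indicator (- cr) z + ennreal (a z * g h (t z)) * indicator (- cr) z) \<partial>count_space Z)"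
    using pw by (intro nn_integral_mono) auto
  also have "\<dots> = ennreal (2 * \<epsilon>) + ((\<integral>\<^sup>+z. ennreal (p h z) * indicator (- cr) z \<partial>count_space Z) +
      (\<integral>\<^sup>+z. ennreal (a z * g h (t z)) * indicator (- cr) z \<partial>count_space Z))"
    by (simp add: nn_integral_add nn_integral_cmult nn_integral_p[OF h])
  also have "(\<integral>\<^sup>+z. ennreal (p h z) * indicator (- cr) z \<partial>count_space Z) = emeasure (law_E E v h) (- cr)"
    using nn_integral_law[OF h, of "indicator (- cr)"] by (simp add: law_E_def)
  also have "(\<integral>\<^sup>+z. ennreal (a z * g h (t z)) * indicator (- cr) z \<partial>count_space Z)
     = (\<integral>\<^sup>+z. ennreal (a z * g h (t z)) \<partial>count_space (Z - cr))"
    by (auto simp: nn_integral_count_space_indicator indicator_def intro!: nn_integral_cong)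
  also have "ennreal (2 * \<epsilon>) + (emeasure (law_E E v h) (- cr) + (\<integral>\<^sup>+z. ennreal (a z * g h (t z)) \<partial>count_space (Z - cr)))
      \<le> ennreal (2 * \<epsilon>) + ennreal \<tau>"
    using plg2_core(1)[OF h] by (intro add_left_mono)
  finally show ?thesis using error_ranges by (simp add: ennreal_plus)
qed

text \<open>Within a cell the density differs from its value at the embedded point by at most the
  integral of its absolute derivative over the cell. Integration over the cell adds a factor at most
  \<kappa>, and disjointness adds the cells up to at most the total variation.\<close>

lemma quadrature_error:
  "(\<integral>\<^sup>+z. \<integral>\<^sup>+y. ennreal \<bar>g h (t z) - g h y\<bar> * indicator (I z) y \<partial>lborel \<partial>count_space Z)
   \<le> ennreal (\<kappa> * sqrt (2 / (pi * v)))"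
proof -
  let ?s = "gauss_slope v h"
  let ?V = "\<lambda>z. \<integral>\<^sup>+y. ennreal (?s y) * indicator (I z) y \<partial>lborel"
  have cell: "(\<integral>\<^sup>+y. ennreal \<bar>g h (t z) - g h y\<bar> * indicator (I z) y \<partial>lborel) \<le> ennreal \<kappa> * ?V z" if z: "z \<in> Z" for z
  proof -
    have "(\<integral>\<^sup>+y. ennreal \<bar>g h (t z) - g h y\<bar> * indicator (I z) y \<partial>lborel) \<le> (\<integral>\<^sup>+y. ?V z * indicator (I z) y \<partial>lborel)"
    proof (rule nn_integral_mono)
      fix y
      show "ennreal \<bar>g h (t z) - g h y\<bar> * indicator (I z) y \<le> ?V z * indicator (I z) y"
      proof (cases "y \<in> I z")
        case True
        have "open_segment y (t z) \<subseteq> I z"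
          using in_interior_closure_convex_segment[OF _ True cells(3)[OF z]] cells(1)[OF z]
          by (simp add: is_interval_convex)
        then show ?thesis using gauss_diff_le[OF v_pos, of y "t z" "I z" h] True
          by (simp add: abs_minus_commute)
      qed simp
    qed
    also have "\<dots> = ?V z * ennreal (a z)" using z by (simp add: nn_integral_cmult_indicator emeasure_I)
    also have "\<dots> \<le> ?V z * ennreal \<kappa>" using z by (intro mult_left_mono a_le) auto
    finally show ?thesis by (simp add: mult.commute)
  qed
  have "(\<integral>\<^sup>+z. \<integral>\<^sup>+y. ennreal \<bar>g h (t z) - g h y\<bar> * indicator (I z) y \<partial>lborel \<partial>count_space Z)
      \<le> ennreal \<kappa> * (\<integral>\<^sup>+z. ?V z \<partial>count_space Z)"
    using cell by (subst nn_integral_cmult[symmetric]) (auto intro!: nn_integral_mono)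
  also have "(\<integral>\<^sup>+z. ?V z \<partial>count_space Z) = (\<integral>\<^sup>+z. emeasure (density lborel (\<lambda>y. ennreal (?s y))) (I z) \<partial>count_space Z)"
    by (intro nn_integral_cong) (simp add: emeasure_density)
  also have "\<dots> = emeasure (density lborel (\<lambda>y. ennreal (?s y))) U"
    by (rule emeasure_UN_countable[symmetric]) (auto simp: disjoint_I)
  also have "\<dots> \<le> emeasure (density lborel (\<lambda>y. ennreal (?s y))) UNIV"
    by (intro emeasure_mono) auto
  also have "\<dots> = ennreal (sqrt (2 / (pi * v)))"
    by (simp add: emeasure_density nn_integral_gauss_slope[OF v_pos])
  finally show ?thesis using error_ranges v_pos by (simp add: ennreal_mult mult_left_mono)
qed

lemma outside_error: "(\<integral>\<^sup>+y. ennreal (mass \<pi> (\<lambda>h. g h y)) * indicator (- U) y \<partial>lborel) \<le> ennreal \<beta>"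
proof -
  have out: "(\<integral>\<^sup>+y. ennreal (g h y) * indicator (- U) y \<partial>lborel) \<le> ennreal \<beta>" if h: "h \<in> {-H..H}" for h
  proof -
    have "prob_space (gauss_law v h)"
      by (rule prob_spaceI) (simp add: gauss_law_def emeasure_density nn_integral_gauss[OF v_pos])
    then interpret G: prob_space "gauss_law v h" .
    have "(\<integral>\<^sup>+y. ennreal (g h y) * indicator (- U) y \<partial>lborel) = (\<integral>\<^sup>+y. ennreal (g h y) * indicator (- window E v) y \<partial>lborel)"
      using AE_U_window by (intro nn_integral_cong_AE, eventually_elim) (auto simp: indicator_def)
    also have "\<dots> = emeasure (gauss_law v h) (- window E v)"
      using window_borel by (simp add: gauss_law_def emeasure_density)
    also have "\<dots> = ennreal (measure (gauss_law v h) (- window E v))" by (rule G.emeasure_eq_measure)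
    also have "\<dots> \<le> ennreal \<beta>" using plg3 v_K h by (auto simp: PLG3_def intro!: ennreal_leI)
    finally show ?thesis .
  qed
  have "(\<integral>\<^sup>+y. ennreal (mass \<pi> (\<lambda>h. g h y)) * indicator (- U) y \<partial>lborel) = (\<integral>\<^sup>+y. \<integral>\<^sup>+h. ennreal (g h y) * indicator (- U) y \<partial>\<pi> \<partial>lborel)"
    by (simp add: nn_integral_multc nn_integral_mass gauss_weight[OF v_pos])
  also have "\<dots> = (\<integral>\<^sup>+h. \<integral>\<^sup>+y. ennreal (g h y) * indicator (- U) y \<partial>lborel \<partial>\<pi>)"
    by (rule prior_swap_lborel[symmetric]) measurable
  also have "\<dots> \<le> (\<integral>\<^sup>+h. ennreal \<beta> \<partial>\<pi>)" using out by (intro nn_integral_mono) (simp add: space_\<pi>)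
  finally show ?thesis by (simp add: emeasure_space_1)
qed

lemma risk_functional_transfer:
  assumes F: "risk_functional F A B"
  defines "S \<equiv> \<integral>\<^sup>+z. ennreal (F (\<lambda>h. p h z)) \<partial>count_space Z"
    and "J \<equiv> \<integral>\<^sup>+y. ennreal (F (\<lambda>h. g h y)) \<partial>lborel"
  shows "S \<le> ennreal A" and "\<bar>enn2real S - enn2real J\<bar> \<le> B * (2 * \<epsilon> + \<tau> + \<kappa> * sqrt (2 / (pi * v)) + \<beta>)"
proof -
  define G where "G y = ennreal (F (\<lambda>h. g h y))" for y
  define b where "b = 2 * \<epsilon> + \<tau> + \<kappa> * sqrt (2 / (pi * v))"
  define X1 where "X1 z = (\<integral>\<^sup>+h. ennreal \<bar>p h z - a z * g h (t z)\<bar> \<partial>\<pi>)" for z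
  define X2 where "X2 z = (\<integral>\<^sup>+y. (\<integral>\<^sup>+h. ennreal \<bar>g h (t z) - g h y\<bar> \<partial>\<pi>) * indicator (I z) y \<partial>lborel)" for z
  have AB: "0 \<le> A" "A \<le> B" "0 \<le> B"
    and F0: "weight f \<Longrightarrow> 0 \<le> F f" and FA: "weight f \<Longrightarrow> F f \<le> A * mass \<pi> f"
    and FC: "F (\<lambda>h. c * f h) = c * F f" for f c
    using F by (auto simp: risk_functional_def)
  have b0: "0 \<le> b" using error_ranges v_pos by (simp add: b_def)
  have "(\<lambda>y. F (\<lambda>h. g h y)) \<in> borel_measurable borel"
    using F unfolding risk_functional_def by blast
  then have [measurable]: "G \<in> borel_measurable borel" unfolding G_def by measurable
  note gw = gauss_weight[OF v_pos]
  have agw: "weight (\<lambda>h. a z * g h (t z))" for z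
    using gw[of "t z"] a_nonneg[of z] by (auto simp: weight_def)
  have X1_sum: "(\<integral>\<^sup>+z. X1 z \<partial>count_space Z) \<le> ennreal (2 * \<epsilon> + \<tau>)"
  proof -
    have "(\<integral>\<^sup>+z. X1 z \<partial>count_space Z) = (\<integral>\<^sup>+h. \<integral>\<^sup>+z. ennreal \<bar>p h z - a z * g h (t z)\<bar> \<partial>count_space Z \<partial>\<pi>)"
      unfolding X1_def by (rule prior_swap_Z[symmetric]) measurable
    also have "\<dots> \<le> (\<integral>\<^sup>+h. ennreal (2 * \<epsilon> + \<tau>) \<partial>\<pi>)"
      using density_error by (intro nn_integral_mono) (simp add: space_\<pi>)
    finally show ?thesis by (simp add: emeasure_space_1)
  qed
  have X2_sum: "(\<integral>\<^sup>+z. X2 z \<partial>count_space Z) \<le> ennreal (\<kappa> * sqrt (2 / (pi * v)))"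
  proof -
    have "X2 z = (\<integral>\<^sup>+h. \<integral>\<^sup>+y. ennreal \<bar>g h (t z) - g h y\<bar> * indicator (I z) y \<partial>lborel \<partial>\<pi>)" for z
      by (subst prior_swap_lborel) (simp_all add: X2_def nn_integral_multc)
    then have "(\<integral>\<^sup>+z. X2 z \<partial>count_space Z) =
        (\<integral>\<^sup>+z. \<integral>\<^sup>+h. \<integral>\<^sup>+y. ennreal \<bar>g h (t z) - g h y\<bar> * indicator (I z) y \<partial>lborel \<partial>\<pi> \<partial>count_space Z)"
      by (intro nn_integral_cong)
    also have "\<dots> =
        (\<integral>\<^sup>+h. \<integral>\<^sup>+z. \<integral>\<^sup>+y. ennreal \<bar>g h (t z) - g h y\<bar> * indicator (I z) y \<partial>lborel \<partial>count_space Z \<partial>\<pi>)"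
      by (rule prior_swap_Z[symmetric]) measurable
    also have "\<dots> \<le> (\<integral>\<^sup>+h. ennreal (\<kappa> * sqrt (2 / (pi * v))) \<partial>\<pi>)"
      by (intro nn_integral_mono quadrature_error)
    finally show ?thesis by (simp add: emeasure_space_1)
  qed
  have X_sum: "(\<integral>\<^sup>+z. ennreal B * (X1 z + X2 z) \<partial>count_space Z) \<le> ennreal (B * b)"
  proof -
    have "(\<integral>\<^sup>+z. ennreal B * (X1 z + X2 z) \<partial>count_space Z) = ennreal B * ((\<integral>\<^sup>+z. X1 z \<partial>count_space Z) + (\<integral>\<^sup>+z. X2 z \<partial>count_space Z))"
      by (simp add: nn_integral_cmult nn_integral_add)
    also have "\<dots> \<le> ennreal B * (ennreal (2 * \<epsilon> + \<tau>) + ennreal (\<kappa> * sqrt (2 / (pi * v))))"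
      by (intro mult_left_mono add_mono X1_sum X2_sum) auto
    also have "ennreal (2 * \<epsilon> + \<tau>) + ennreal (\<kappa> * sqrt (2 / (pi * v))) = ennreal b"
      unfolding b_def using error_ranges v_pos by (intro ennreal_plus[symmetric]) auto
    also have "ennreal B * ennreal b = ennreal (B * b)"
      using AB b0 by (simp add: ennreal_mult)
    finally show ?thesis .
  qed
  have lip: "G s \<le> G r + ennreal B * (\<integral>\<^sup>+h. ennreal \<bar>g h s - g h r\<bar> \<partial>\<pi>)" for s r
    unfolding G_def by (rule risk_functional_lipschitz[OF F gw gw])
  \<comment> \<open>Here homogeneity turns the factor \<open>a z\<close> into an integral of a
    constant over the cell.\<close>
  have aG: "ennreal (F (\<lambda>h. a z * g h (t z))) = (\<integral>\<^sup>+y. G (t z) * indicator (I z) y \<partial>lborel)" if "z \<in> Z" for z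
    using that F0[OF gw] a_nonneg[of z]
    by (simp add: FC G_def ennreal_mult nn_integral_cmult_indicator emeasure_I mult.commute[of "ennreal (a z)"])
  let ?C = "\<lambda>z. \<integral>\<^sup>+y. G y * indicator (I z) y \<partial>lborel"
  have up: "ennreal (F (\<lambda>h. p h z)) \<le> ?C z + ennreal B * (X1 z + X2 z)" if z: "z \<in> Z" for z
  proof -
    have "(\<integral>\<^sup>+y. G (t z) * indicator (I z) y \<partial>lborel) \<le>
      (\<integral>\<^sup>+y. G y * indicator (I z) y + ennreal B * ((\<integral>\<^sup>+h. ennreal \<bar>g h (t z) - g h y\<bar> \<partial>\<pi>) * indicator (I z) y) \<partial>lborel)"
      using lip[of "t z"] by (intro nn_integral_mono) (auto simp: indicator_def)
    also have "\<dots> = ?C z + ennreal B * X2 z"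
      by (simp add: nn_integral_add nn_integral_cmult X2_def)
    finally have "ennreal (F (\<lambda>h. a z * g h (t z))) \<le> ?C z + ennreal B * X2 z" by (simp add: aG[OF z])
    moreover have "ennreal (F (\<lambda>h. p h z)) \<le> ennreal (F (\<lambda>h. a z * g h (t z))) + ennreal B * X1 z"
      unfolding X1_def by (rule risk_functional_lipschitz[OF F p_weight[OF z] agw])
    ultimately have "ennreal (F (\<lambda>h. p h z)) \<le> (?C z + ennreal B * X2 z) + ennreal B * X1 z"
      by (meson add_right_mono order_trans)
    then show ?thesis by (simp add: distrib_left ac_simps)
  qed
  have lo: "?C z \<le> ennreal (F (\<lambda>h. p h z)) + ennreal B * (X1 z + X2 z)" if z: "z \<in> Z" for z
  proof -
    have "?C z \<le>
      (\<integral>\<^sup>+y. G (t z) * indicator (I z) y + ennreal B * ((\<integral>\<^sup>+h. ennreal \<bar>g h (t z) - g h y\<bar> \<partial>\<pi>) * indicator (I z) y) \<partial>lborel)"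
      using lip[of _ "t z"] by (intro nn_integral_mono) (auto simp: indicator_def abs_minus_commute)
    also have "\<dots> = ennreal (F (\<lambda>h. a z * g h (t z))) + ennreal B * X2 z"
      by (simp add: nn_integral_add nn_integral_cmult X2_def aG[OF z])
    finally have "?C z \<le> ennreal (F (\<lambda>h. a z * g h (t z))) + ennreal B * X2 z" .
    moreover have "ennreal (F (\<lambda>h. a z * g h (t z))) \<le> ennreal (F (\<lambda>h. p h z)) + ennreal B * X1 z"
      using risk_functional_lipschitz[OF F agw p_weight[OF z], of z] by (simp add: X1_def abs_minus_commute)
    ultimately have "?C z \<le> (ennreal (F (\<lambda>h. p h z)) + ennreal B * X1 z) + ennreal B * X2 z"
      by (meson add_right_mono order_trans)
    then show ?thesis by (simp add: distrib_left ac_simps)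
  qed
  have C_sum: "(\<integral>\<^sup>+z. ?C z \<partial>count_space Z) = (\<integral>\<^sup>+y. G y * indicator U y \<partial>lborel)"
  proof -
    have "(\<integral>\<^sup>+z. ?C z \<partial>count_space Z) = (\<integral>\<^sup>+z. emeasure (density lborel G) (I z) \<partial>count_space Z)"
      by (intro nn_integral_cong) (simp add: emeasure_density)
    also have "\<dots> = emeasure (density lborel G) U"
      by (rule emeasure_UN_countable[symmetric]) (auto simp: disjoint_I)
    finally show ?thesis by (simp add: emeasure_density)
  qed
  have J_split: "J = (\<integral>\<^sup>+y. G y * indicator U y \<partial>lborel) + (\<integral>\<^sup>+y. G y * indicator (- U) y \<partial>lborel)"
    unfolding J_def G_def[symmetric]
    by (subst nn_integral_add[symmetric]) (auto intro!: nn_integral_cong simp: indicator_def)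
  have out: "(\<integral>\<^sup>+y. G y * indicator (- U) y \<partial>lborel) \<le> ennreal (A * \<beta>)"
  proof -
    have "(\<integral>\<^sup>+y. G y * indicator (- U) y \<partial>lborel) \<le> (\<integral>\<^sup>+y. ennreal A * (ennreal (mass \<pi> (\<lambda>h. g h y)) * indicator (- U) y) \<partial>lborel)"
      using FA[OF gw] AB by (intro nn_integral_mono)
        (auto simp: G_def indicator_def mass_nonneg[OF gw] simp flip: ennreal_mult intro!: ennreal_leI)
    also have "\<dots> \<le> ennreal A * ennreal \<beta>"
      by (subst nn_integral_cmult) (auto simp del: Compl_UN intro!: mult_left_mono outside_error)
    finally show ?thesis using AB error_ranges by (simp add: ennreal_mult)
  qed
  have "S \<le> (\<integral>\<^sup>+z. ennreal A * ennreal (mass \<pi> (\<lambda>h. p h z)) \<partial>count_space Z)"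
    unfolding S_def using FA[OF p_weight] AB
    by (intro nn_integral_mono) (auto simp: mass_nonneg[OF p_weight] simp flip: ennreal_mult intro!: ennreal_leI)
  also have "\<dots> = ennreal A" by (simp add: nn_integral_cmult nn_integral_p_mass)
  finally show SA: "S \<le> ennreal A" .
  have "S \<le> (\<integral>\<^sup>+z. ?C z + ennreal B * (X1 z + X2 z) \<partial>count_space Z)"
    unfolding S_def using up by (intro nn_integral_mono) auto
  also have "\<dots> \<le> (\<integral>\<^sup>+y. G y * indicator U y \<partial>lborel) + ennreal (B * b)"
    by (subst nn_integral_add) (auto simp: C_sum intro!: add_left_mono X_sum)
  also have "\<dots> \<le> J + ennreal (B * (b + \<beta>))"
    using AB error_ranges b0 unfolding J_split
    by (intro add_mono ennreal_leI mult_left_mono) auto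
  finally have 1: "S \<le> J + ennreal (B * (b + \<beta>))" .
  have "(\<integral>\<^sup>+y. G y * indicator U y \<partial>lborel) \<le> (\<integral>\<^sup>+z. ennreal (F (\<lambda>h. p h z)) + ennreal B * (X1 z + X2 z) \<partial>count_space Z)"
    unfolding C_sum[symmetric] using lo by (intro nn_integral_mono) auto
  also have "\<dots> \<le> S + ennreal (B * b)"
    by (subst nn_integral_add) (auto simp: S_def intro!: add_left_mono X_sum)
  finally have "J \<le> S + ennreal (B * b) + ennreal (A * \<beta>)"
    unfolding J_split using out by (rule add_mono)
  \<comment> \<open>The window error enters with A only; it is weakened to B to share the common
    factor.\<close>
  also have "\<dots> \<le> S + (ennreal (B * b) + ennreal (B * \<beta>))"
    unfolding add.assoc using AB error_ranges by (intro add_left_mono ennreal_leI mult_right_mono)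
  also have "\<dots> = S + ennreal (B * (b + \<beta>))"
    using AB error_ranges b0 by (simp add: distrib_left ennreal_plus)
  finally have 2: "J \<le> S + ennreal (B * (b + \<beta>))" .
  show "\<bar>enn2real S - enn2real J\<bar> \<le> B * (2 * \<epsilon> + \<tau> + \<kappa> * sqrt (2 / (pi * v)) + \<beta>)"
    using enn2real_diff_le[OF 1 2 le_less_trans[OF SA]] AB error_ranges b0
    by (simp add: b_def)
qed

end

section \<open>Dirichlet energy\<close>

context plg_level
begin

abbreviation m where "m z \<equiv> avg \<pi> (\<lambda>h. p h z)"

definition post_variance :: "'z \<Rightarrow> real" where
  "post_variance z = spread \<pi> (\<lambda>h. p h z) / mass \<pi> (\<lambda>h. p h z)"

definition jump_energy :: "'z \<Rightarrow> ennreal" where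
  "jump_energy z = (\<integral>\<^sup>+z'. ennreal (rate E v z z' * (m z' - m z)\<^sup>2) \<partial>count_space (succs E v z))"

lemma dirichlet_energy_eq: "dirichlet_energy E v \<pi> = (\<integral>\<^sup>+h. \<integral>\<^sup>+z. jump_energy z \<partial>law_E E v h \<partial>\<pi>)"
  by (simp add: dirichlet_energy_def jump_energy_def post_mean_eq_avg)

lemma post_variance_bounds:
  assumes "z \<in> Z"
  shows "0 \<le> post_variance z" "post_variance z \<le> H\<^sup>2"
proof -
  show "0 \<le> post_variance z"
    using assms by (simp add: post_variance_def spread_nonneg mass_nonneg p_weight)
  show "post_variance z \<le> H\<^sup>2"
    using spread_le_mass[OF p_weight[OF assms]] mass_nonneg[OF p_weight[OF assms]]
    by (cases "mass \<pi> (\<lambda>h. p h z) = 0") (auto simp: post_variance_def field_simps)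
qed

lemma post_variance_sq_le: "z \<in> Z \<Longrightarrow> (post_variance z)\<^sup>2 \<le> H ^ 4"
  using power_mono[OF post_variance_bounds(2) post_variance_bounds(1), of z 2] by simp

lemma active_pos:
  assumes "active E v z z'" "h \<in> {-H..H}"
  shows "0 < p h z" "0 < p h z'"
  using lattice v_K assms by (auto simp: lattice_experiment_def)

lemma activeD: "active E v z z' \<Longrightarrow> z \<in> Z \<and> z' \<in> Z \<and> 0 < rate E v z z'"
  by (simp add: active_def)

section \<open>Moves of the posterior mean along edges\<close>

lemma exp_llr:
  assumes "active E v z z'" "h \<in> {-H..H}"
  shows "p h z' = exp (llr E v z z' h) * p h z"
  using active_pos[OF assms] by (simp add: llr_def)

text \<open>Up to the factor exp of the infimum, the likelihood ratio lies between 1 and exp of the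
  oscillation, so the sandwich bound applies. The minimum with 1 comes from the trivial bound 2 H on
  the distance between two posterior means, which also serves for infinite oscillation.\<close>

lemma edge_weight_bound:
  assumes act: "active E v z z'"
  shows "(m z' - m z)\<^sup>2 \<le> 4 * H\<^sup>2 * osc_weight (llr_osc E v H z z')"
proof -
  let ?l = "llr E v z z'"
  have z: "z \<in> Z" "z' \<in> Z" using activeD[OF act] by auto
  have H0: "0 \<in> {-H..H}" using H_pos by simp
  define s where "s = (SUP h\<in>{-H..H}. ereal (?l h))"
  define i where "i = (INF h\<in>{-H..H}. ereal (?l h))"
  have osc: "llr_osc E v H z z' = s - i" by (simp add: llr_osc_def s_def i_def)
  have il: "i \<le> ereal (?l h)" "ereal (?l h) \<le> s" if "h \<in> {-H..H}" for h
    using that by (auto simp: s_def i_def intro: INF_lower SUP_upper)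
  have "\<bar>m z' - m z\<bar> \<le> 2 * H" using avg_bound[OF p_weight[OF z(1)]] avg_bound[OF p_weight[OF z(2)]] by linarith
  then have trivial: "(m z' - m z)\<^sup>2 \<le> 4 * H\<^sup>2"
    using power_mono[of "\<bar>m z' - m z\<bar>" "2 * H" 2] by (simp add: power_mult_distrib)
  show ?thesis
  proof (cases "s - i = \<infinity>")
    case True
    then show ?thesis using trivial by (simp add: osc osc_weight_def)
  next
    case False
    \<comment> \<open>The value at parameter 0 lies between \<open>i\<close> and \<open>s\<close>,
      so \<open>s\<close> is not minus infinity and \<open>i\<close> is not plus infinity; if their
      difference is not infinite, both are real.\<close>
    then obtain rs ri where r: "s = ereal rs" "i = ereal ri"
      using il[OF H0] by (cases s; cases i) auto
    have "\<bar>m z' - m z\<bar> \<le> 2 * H * (exp (rs - ri) - 1)"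
    proof (rule avg_diff_sandwich[OF p_weight[OF z(1)] p_weight[OF z(2)]])
      show "0 < mass \<pi> (\<lambda>h. p h z)" using active_pos[OF act] by (intro mass_pos p_weight z)
      show "0 < exp ri" by simp
      show "exp ri * p h z \<le> p h z' \<and> p h z' \<le> exp ri * exp (rs - ri) * p h z" if h: "h \<in> {-H..H}" for h
        using il[OF h] r unfolding exp_llr[OF act h]
        by (auto simp flip: exp_add intro!: mult_right_mono p_nonneg)
    qed
    then have "\<bar>m z' - m z\<bar>\<^sup>2 \<le> (2 * H * (exp (rs - ri) - 1))\<^sup>2" by (rule power_mono) simp
    then have "(m z' - m z)\<^sup>2 \<le> 4 * H\<^sup>2 * (exp (rs - ri) - 1)\<^sup>2" by (simp add: power_mult_distrib)
    then show ?thesis using trivial r by (auto simp: osc osc_weight_def min_def)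
  qed
qed

lemma jump_energy_le_Gam: "jump_energy z \<le> Gam E v H z"
proof -
  have "jump_energy z \<le> (\<integral>\<^sup>+z'. ennreal (4 * H\<^sup>2) * ennreal (rate E v z z' * osc_weight (llr_osc E v H z z'))
      \<partial>count_space (succs E v z))"
    unfolding jump_energy_def
  proof (rule nn_integral_mono)
    fix z' assume "z' \<in> space (count_space (succs E v z))"
    then have act: "active E v z z'" by (simp add: succs_def)
    have "rate E v z z' * (m z' - m z)\<^sup>2 \<le> rate E v z z' * (4 * H\<^sup>2 * osc_weight (llr_osc E v H z z'))"
      using edge_weight_bound[OF act] activeD[OF act] by (intro mult_left_mono) auto
    then show "ennreal (rate E v z z' * (m z' - m z)\<^sup>2) \<le>
        ennreal (4 * H\<^sup>2) * ennreal (rate E v z z' * osc_weight (llr_osc E v H z z'))"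
      by (simp add: ennreal_leI mult.left_commute flip: ennreal_mult')
  qed
  also have "\<dots> = Gam E v H z" by (simp add: Gam_def nn_integral_cmult)
  finally show ?thesis .
qed

text \<open>The sign of \<open>c0\<close> is left open and \<open>ennreal c0\<close> is zero for
  negative values, so the real bound extracted from the edge condition is
  \<open>max c0 0\<close>.\<close>

abbreviation energy_const where
  "energy_const \<equiv> 2 * edge_const (max c0 0) + (edge_const (max c0 0))\<^sup>2"

lemma energy_const_nonneg: "0 \<le> energy_const"
  using edge_const_nonneg[of "max c0 0"] by simp

text \<open>The number \<open>e\<close> is the bracket of \<open>Xi\<close> as a real: the edge
  condition makes \<open>omega\<close> finite for origins in the core. The tilt estimate then
  applies with the likelihood ratio of the edge as the tilt.\<close>

lemma core_edge:
  assumes z: "z \<in> cr" and act: "active E v z z'"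
  obtains e where "0 \<le> e"
    "ennreal e = ennreal (\<bar>slope E v z z'\<bar> * H ^ 3) * bigB E v H z z' + ennreal (H\<^sup>2) * (bigB E v H z z')\<^sup>2"
    "\<bar>(m z' - m z)\<^sup>2 - (slope E v z z')\<^sup>2 * (post_variance z)\<^sup>2\<bar> \<le> energy_const * e"
proof -
  define \<alpha> where "\<alpha> = slope E v z z'"
  define w where "w = enn2real (omega E v H z z')"
  define l where "l = llr E v z z'"
  have zZ: "z \<in> Z" "z' \<in> Z" using activeD[OF act] by auto
  have bound: "ennreal (\<bar>\<alpha>\<bar> * H) + 2 * omega E v H z z' \<le> ennreal c0"
    using plg4 v_K z act unfolding PLG4_def \<alpha>_def by blast
  have "2 * omega E v H z z' \<le> ennreal c0" using bound by (rule order_trans[rotated]) simp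
  then have "2 * omega E v H z z' < top" by (rule le_less_trans) simp
  then have "omega E v H z z' < top" by (auto simp: ennreal_mult_less_top)
  then have om: "omega E v H z z' = ennreal w" by (simp add: w_def)
  have w0: "0 \<le> w" by (simp add: w_def)
  have "ennreal (\<bar>\<alpha>\<bar> * H + 2 * w) = ennreal (\<bar>\<alpha>\<bar> * H) + 2 * omega E v H z z'"
    using w0 H_pos by (simp add: om ennreal_plus ennreal_mult)
  also have "\<dots> \<le> ennreal (max c0 0)" using bound by (rule order_trans) (simp add: ennreal_leI)
  finally have c: "\<bar>\<alpha>\<bar> * H + 2 * w \<le> max c0 0" by (subst (asm) ennreal_le_iff) auto
  define B where "B = \<alpha>\<^sup>2 * H\<^sup>2 + w"
  have B0: "0 \<le> B" using w0 by (simp add: B_def)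
  have Bb: "bigB E v H z z' = ennreal B"
    using w0 by (simp add: bigB_def om B_def \<alpha>_def ennreal_plus)
  \<comment> \<open>The value of the ratio at 0 only rescales the weight and cancels in the average.
    The increment differs from its linear part by the remainder, hence by at most
    \<open>w\<close>.\<close>
  define x where "x h = l h - l 0" for h
  have xm: "x \<in> borel_measurable \<pi>"
    using zZ unfolding x_def l_def llr_def by measurable
  have xb: "\<bar>x h - \<alpha> * h\<bar> \<le> w" if h: "h \<in> {-H..H}" for h
  proof -
    have "ennreal \<bar>remainder E v z z' h\<bar> \<le> omega E v H z z'"
      unfolding omega_def using h by (rule SUP_upper)
    then have "\<bar>remainder E v z z' h\<bar> \<le> w" using w0 by (simp add: om)
    then show ?thesis by (simp add: remainder_def x_def l_def \<alpha>_def)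
  qed
  have "m z' = avg \<pi> (\<lambda>h. exp (l 0) * (exp (x h) * p h z))"
    by (rule avg_cong) (simp add: exp_llr[OF act] x_def l_def exp_diff)
  then have "\<bar>(m z' - m z)\<^sup>2 - \<alpha>\<^sup>2 * (post_variance z)\<^sup>2\<bar> \<le> energy_const * (\<bar>\<alpha>\<bar> * H ^ 3 * B + H\<^sup>2 * B\<^sup>2)"
    using avg_tilt_square[OF p_weight[OF zZ(1)] _ _ w0 xm xb c, of "exp (l 0)"]
      mass_pos[OF p_weight[OF zZ(1)] active_pos(1)[OF act]]
    by (simp add: post_variance_def B_def)
  moreover have "ennreal (\<bar>\<alpha>\<bar> * H ^ 3 * B + H\<^sup>2 * B\<^sup>2) =
      ennreal (\<bar>\<alpha>\<bar> * H ^ 3) * bigB E v H z z' + ennreal (H\<^sup>2) * (bigB E v H z z')\<^sup>2"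
    using B0 H_pos by (simp add: Bb ennreal_plus ennreal_mult ennreal_power)
  moreover have "0 \<le> \<bar>\<alpha>\<bar> * H ^ 3 * B + H\<^sup>2 * B\<^sup>2" using B0 H_pos by simp
  ultimately show thesis using that unfolding \<alpha>_def by blast
qed

text \<open>The terms are nonnegative, so summability is absolute and the infinite sum is an
  integral against counting measure, ready for comparison with \<open>jump_energy\<close>.\<close>

lemma core_rate_sum:
  assumes z: "z \<in> cr"
  obtains s where "0 \<le> s" "\<bar>s - 1 / v\<^sup>2\<bar> \<le> \<gamma>"
    "(\<integral>\<^sup>+z'. ennreal (rate E v z z' * (slope E v z z')\<^sup>2) \<partial>count_space (succs E v z)) = ennreal s"
proof -
  let ?f = "\<lambda>z'. rate E v z z' * (slope E v z z')\<^sup>2"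
  have f0: "0 \<le> ?f z'" if "z' \<in> succs E v z" for z'
    using that activeD by (fastforce simp: succs_def)
  have sm: "?f summable_on succs E v z" and g: "\<bar>(\<Sum>\<^sub>\<infinity>z'\<in>succs E v z. ?f z') - 1 / v\<^sup>2\<bar> \<le> \<gamma>"
    using plg4 v_K z unfolding PLG4_def by blast+
  have "(\<lambda>z'. norm (?f z')) summable_on succs E v z"
    using sm by (rule summable_on_cong[THEN iffD1, rotated]) (use f0 in auto)
  then have ab: "Infinite_Set_Sum.abs_summable_on ?f (succs E v z)" by (simp only: abs_summable_equivalent)
  show thesis
  proof (rule that)
    show "0 \<le> (\<Sum>\<^sub>\<infinity>z'\<in>succs E v z. ?f z')" by (rule infsum_nonneg) (rule f0)
    show "(\<integral>\<^sup>+z'. ennreal (?f z') \<partial>count_space (succs E v z)) = ennreal (\<Sum>\<^sub>\<infinity>z'\<in>succs E v z. ?f z')"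
      using nn_integral_conv_infsetsum[OF ab f0] infsetsum_infsum[OF ab] by simp
  qed (rule g)
qed

text \<open>The first term is the cost of linearising along the edges, the second that of replacing
  the weighted sum of squared slopes by 1/v^2, multiplied by a squared variance of at most
  H^4.\<close>

definition core_error :: real where
  "core_error = energy_const * \<xi> + H ^ 4 * \<gamma>"

text \<open>Along each edge the squared move of the mean is close to the squared slope times the
  squared variance W^2. The latter does not depend on the edge and comes out of the sum, leaving W^2
  times the sum of rate times squared slope.\<close>

lemma core_jump_energy:
  assumes z: "z \<in> cr"
  shows "jump_energy z \<le> ennreal ((post_variance z)\<^sup>2 / v\<^sup>2) + ennreal core_error"
    and "ennreal ((post_variance z)\<^sup>2 / v\<^sup>2) \<le> jump_energy z + ennreal core_error"
proof -
  let ?M = "count_space (succs E v z)" and ?q = "rate E v z" and ?W2 = "(post_variance z)\<^sup>2"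
  let ?X = "\<lambda>z'. ennreal (?q z') * (ennreal (\<bar>slope E v z z'\<bar> * H ^ 3) * bigB E v H z z' + ennreal (H\<^sup>2) * (bigB E v H z z')\<^sup>2)"
  obtain s where s: "0 \<le> s" "\<bar>s - 1 / v\<^sup>2\<bar> \<le> \<gamma>"
    "(\<integral>\<^sup>+z'. ennreal (?q z' * (slope E v z z')\<^sup>2) \<partial>?M) = ennreal s"
    using core_rate_sum[OF z] .
  have zZ: "z \<in> Z" using z core_subset by auto
  have Xi: "(\<integral>\<^sup>+z'. ennreal energy_const * ?X z' \<partial>?M) \<le> ennreal (energy_const * \<xi>)"
  proof -
    have "Xi E v H z \<le> ennreal \<xi>" using plg4 v_K z unfolding PLG4_def by blast
    then have "ennreal energy_const * Xi E v H z \<le> ennreal energy_const * ennreal \<xi>" by (rule mult_left_mono) simp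
    then show ?thesis
      using energy_const_nonneg error_ranges by (simp add: nn_integral_cmult Xi_def ennreal_mult)
  qed
  have edge: "ennreal (?q z' * (m z' - m z)\<^sup>2) \<le> ennreal ?W2 * ennreal (?q z' * (slope E v z z')\<^sup>2) + ennreal energy_const * ?X z'
     \<and> ennreal ?W2 * ennreal (?q z' * (slope E v z z')\<^sup>2) \<le> ennreal (?q z' * (m z' - m z)\<^sup>2) + ennreal energy_const * ?X z'"
    if "z' \<in> succs E v z" for z'
  proof -
    have act: "active E v z z'" using that by (simp add: succs_def)
    obtain e where e: "0 \<le> e"
      "ennreal e = ennreal (\<bar>slope E v z z'\<bar> * H ^ 3) * bigB E v H z z' + ennreal (H\<^sup>2) * (bigB E v H z z')\<^sup>2"
      "\<bar>(m z' - m z)\<^sup>2 - (slope E v z z')\<^sup>2 * ?W2\<bar> \<le> energy_const * e"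
      using core_edge[OF z act] .
    have q: "0 \<le> ?q z'" using activeD[OF act] by simp
    have ce: "0 \<le> energy_const * e" using energy_const_nonneg e(1) by (rule mult_nonneg_nonneg)
    have X: "ennreal energy_const * ?X z' = ennreal (?q z' * (energy_const * e))"
      unfolding e(2)[symmetric] using energy_const_nonneg q e(1)
      by (simp add: ac_simps flip: ennreal_mult')
    have W: "ennreal ?W2 * ennreal (?q z' * (slope E v z z')\<^sup>2) = ennreal (?q z' * ((slope E v z z')\<^sup>2 * ?W2))"
      by (simp add: ac_simps flip: ennreal_mult')
    have "?q z' * (m z' - m z)\<^sup>2 \<le> ?q z' * ((slope E v z z')\<^sup>2 * ?W2) + ?q z' * (energy_const * e)"
         "?q z' * ((slope E v z z')\<^sup>2 * ?W2) \<le> ?q z' * (m z' - m z)\<^sup>2 + ?q z' * (energy_const * e)"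
      using e(3) q unfolding distrib_left[symmetric] by (intro mult_left_mono; linarith)+
    then show ?thesis unfolding X W
      using q ce by (simp add: ennreal_leI flip: ennreal_plus)
  qed
  have sW: "?W2 * s \<le> ?W2 / v\<^sup>2 + H ^ 4 * \<gamma>" "?W2 / v\<^sup>2 \<le> ?W2 * s + H ^ 4 * \<gamma>"
  proof -
    have "\<bar>?W2 * s - ?W2 / v\<^sup>2\<bar> = ?W2 * \<bar>s - 1 / v\<^sup>2\<bar>"
      using abs_mult[of ?W2 "s - 1 / v\<^sup>2"] by (simp add: right_diff_distrib)
    also have "\<dots> \<le> H ^ 4 * \<gamma>" using s(2) post_variance_sq_le[OF zZ] by (intro mult_mono) auto
    finally show "?W2 * s \<le> ?W2 / v\<^sup>2 + H ^ 4 * \<gamma>" "?W2 / v\<^sup>2 \<le> ?W2 * s + H ^ 4 * \<gamma>" by linarith+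
  qed
  have c0: "0 \<le> energy_const * \<xi>" "0 \<le> H ^ 4 * \<gamma>"
    using energy_const_nonneg error_ranges by (auto intro: mult_nonneg_nonneg)
  have WS: "(\<integral>\<^sup>+z'. ennreal ?W2 * ennreal (?q z' * (slope E v z z')\<^sup>2) \<partial>?M) = ennreal (?W2 * s)"
    using s by (simp add: nn_integral_cmult ennreal_mult)
  have "jump_energy z \<le> (\<integral>\<^sup>+z'. ennreal ?W2 * ennreal (?q z' * (slope E v z z')\<^sup>2) + ennreal energy_const * ?X z' \<partial>?M)"
    unfolding jump_energy_def using edge by (intro nn_integral_mono) auto
  also have "\<dots> \<le> ennreal (?W2 * s) + ennreal (energy_const * \<xi>)"
    using Xi by (simp add: nn_integral_add WS add_left_mono del: nn_integral_cmult)
  also have "\<dots> = ennreal (?W2 * s + energy_const * \<xi>)"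
    using s(1) c0 by (intro ennreal_plus[symmetric]) auto
  also have "\<dots> \<le> ennreal (?W2 / v\<^sup>2 + core_error)"
    using sW by (intro ennreal_leI) (simp add: core_error_def)
  also have "\<dots> = ennreal (?W2 / v\<^sup>2) + ennreal core_error"
    using c0 by (intro ennreal_plus) (auto simp: core_error_def)
  finally show "jump_energy z \<le> ennreal (?W2 / v\<^sup>2) + ennreal core_error" .
  have "ennreal (?W2 / v\<^sup>2) \<le> ennreal (?W2 * s + H ^ 4 * \<gamma>)" using sW by (intro ennreal_leI)
  also have "\<dots> = ennreal (?W2 * s) + ennreal (H ^ 4 * \<gamma>)"
    using s(1) c0 by (intro ennreal_plus) auto
  also have "ennreal (?W2 * s) \<le> (\<integral>\<^sup>+z'. ennreal (?q z' * (m z' - m z)\<^sup>2) + ennreal energy_const * ?X z' \<partial>?M)"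
    unfolding WS[symmetric] using edge by (intro nn_integral_mono) auto
  also have "\<dots> \<le> jump_energy z + ennreal (energy_const * \<xi>)"
    using Xi by (simp add: nn_integral_add jump_energy_def add_left_mono del: nn_integral_cmult)
  finally have "ennreal (?W2 / v\<^sup>2) \<le> jump_energy z + ennreal (energy_const * \<xi>) + ennreal (H ^ 4 * \<gamma>)"
    by (simp add: add_right_mono)
  also have "\<dots> = jump_energy z + ennreal core_error"
    using c0 by (simp add: core_error_def add.assoc ennreal_plus)
  finally show "ennreal (?W2 / v\<^sup>2) \<le> jump_energy z + ennreal core_error" .
qed

lemma core_error_nonneg: "0 \<le> core_error"
  using energy_const_nonneg error_ranges by (auto simp: core_error_def intro!: add_nonneg_nonneg mult_nonneg_nonneg)

text \<open>The two directions lose different quantities off the core. For the upper bound the jump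
  energy there is dominated by \<open>Gam\<close>, giving \<tau>\<Gamma>; for the lower bound it is
  dropped, and the variance term, at most H^4 / v^2, is paid for by the tail probability
  \<tau>.\<close>

lemma dirichlet_energy_diff:
  "\<bar>enn2real (dirichlet_energy E v \<pi>) - enn2real (\<integral>\<^sup>+z. ennreal (energy \<pi> (\<lambda>h. p h z)) \<partial>count_space Z) / v\<^sup>2\<bar>
   \<le> core_error + \<tau>\<Gamma> + H ^ 4 * \<tau> / v\<^sup>2"
proof -
  let ?ind = "indicator (- cr) :: 'z \<Rightarrow> ennreal"
  let ?M = "\<lambda>z. ennreal (mass \<pi> (\<lambda>h. p h z))"
  let ?V = "\<lambda>z. ennreal ((post_variance z)\<^sup>2 / v\<^sup>2)"
  define S where "S = (\<integral>\<^sup>+z. ennreal (energy \<pi> (\<lambda>h. p h z)) \<partial>count_space Z)"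
  define T where "T = (\<integral>\<^sup>+z. ?M z * ?V z \<partial>count_space Z)"
  have T_eq: "T = S / ennreal (v\<^sup>2)"
  proof -
    have "?M z * ?V z = ennreal (energy \<pi> (\<lambda>h. p h z)) / ennreal (v\<^sup>2)" if "z \<in> Z" for z
      using energy_eq[OF p_weight[OF that]] mass_nonneg[OF p_weight[OF that]] v_pos energy_nonneg[OF p_weight[OF that]]
      by (simp add: post_variance_def divide_ennreal flip: ennreal_mult)
    then have "T = (\<integral>\<^sup>+z. ennreal (energy \<pi> (\<lambda>h. p h z)) / ennreal (v\<^sup>2) \<partial>count_space Z)"
      unfolding T_def by (intro nn_integral_cong) auto
    then show ?thesis by (simp add: S_def nn_integral_divide)
  qed
  have Tfin: "T \<le> ennreal (H ^ 4 / v\<^sup>2)"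
  proof -
    have "S \<le> ennreal (H ^ 4)"
      unfolding S_def by (rule risk_functional_transfer(1)[OF risk_functional_energy])
    then have "T \<le> ennreal (H ^ 4) / ennreal (v\<^sup>2)" unfolding T_eq by (rule divide_right_mono_ennreal)
    then show ?thesis using v_pos by (simp add: divide_ennreal)
  qed
  have D_eq: "dirichlet_energy E v \<pi> = (\<integral>\<^sup>+z. ?M z * jump_energy z \<partial>count_space Z)"
    unfolding dirichlet_energy_eq by (rule nn_integral_prior_law)
  have off_Gam: "(\<integral>\<^sup>+z. ?M z * (?ind z * Gam E v H z) \<partial>count_space Z) \<le> ennreal \<tau>\<Gamma>"
  proof -
    have "(\<integral>\<^sup>+z. ?ind z * Gam E v H z \<partial>law_E E v h) \<le> ennreal \<tau>\<Gamma>" if "h \<in> {-H..H}" for h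
    proof -
      have "(SUP h\<in>{-H..H}. \<integral>\<^sup>+z. ?ind z * Gam E v H z \<partial>law_E E v h) \<le> ennreal \<tau>\<Gamma>"
        using plg2 v_K by (simp add: PLG2_def)
      then show ?thesis using that by (meson SUP_upper order_trans)
    qed
    then have "(\<integral>\<^sup>+h. \<integral>\<^sup>+z. ?ind z * Gam E v H z \<partial>law_E E v h \<partial>\<pi>) \<le> (\<integral>\<^sup>+h. ennreal \<tau>\<Gamma> \<partial>\<pi>)"
      by (intro nn_integral_mono) (simp add: space_\<pi>)
    then show ?thesis by (simp add: nn_integral_prior_law emeasure_space_1)
  qed
  have off_var: "(\<integral>\<^sup>+z. ?M z * (?ind z * ennreal (H ^ 4 / v\<^sup>2)) \<partial>count_space Z) \<le> ennreal (H ^ 4 * \<tau> / v\<^sup>2)"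
  proof -
    have "(\<integral>\<^sup>+h. \<integral>\<^sup>+z. ?ind z * ennreal (H ^ 4 / v\<^sup>2) \<partial>law_E E v h \<partial>\<pi>) \<le> (\<integral>\<^sup>+h. ennreal \<tau> * ennreal (H ^ 4 / v\<^sup>2) \<partial>\<pi>)"
      using plg2_core(2) by (intro nn_integral_mono)
        (auto simp: space_\<pi> nn_integral_multc law_E_def intro!: mult_right_mono)
    then show ?thesis using error_ranges
      by (simp add: nn_integral_prior_law emeasure_space_1 mult.commute flip: ennreal_mult)
  qed
  have const: "(\<integral>\<^sup>+z. ?M z * c \<partial>count_space Z) = c" for c
    by (simp add: nn_integral_multc nn_integral_p_mass)
  have 1: "dirichlet_energy E v \<pi> \<le> T + ennreal (core_error + \<tau>\<Gamma> + H ^ 4 * \<tau> / v\<^sup>2)"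
  proof -
    have pt: "jump_energy z \<le> ?V z + (ennreal core_error + ?ind z * Gam E v H z)" for z
    proof (cases "z \<in> cr")
      case True
      then show ?thesis using core_jump_energy(1)[OF True] by simp
    next
      case False
      then show ?thesis using jump_energy_le_Gam[of z] by (simp add: add_increasing)
    qed
    have "dirichlet_energy E v \<pi> \<le> (\<integral>\<^sup>+z. ?M z * ?V z + (?M z * ennreal core_error + ?M z * (?ind z * Gam E v H z)) \<partial>count_space Z)"
      unfolding D_eq distrib_left[symmetric] by (intro nn_integral_mono mult_left_mono pt) simp
    also have "\<dots> = T + (ennreal core_error + (\<integral>\<^sup>+z. ?M z * (?ind z * Gam E v H z) \<partial>count_space Z))"
      by (simp add: nn_integral_add T_def const del: nn_integral_multc)
    also have "\<dots> \<le> T + (ennreal core_error + ennreal \<tau>\<Gamma>)"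
      by (intro add_left_mono off_Gam)
    also have "ennreal core_error + ennreal \<tau>\<Gamma> = ennreal (core_error + \<tau>\<Gamma>)"
      using core_error_nonneg error_ranges by (simp add: ennreal_plus)
    also have "T + ennreal (core_error + \<tau>\<Gamma>) \<le> T + ennreal (core_error + \<tau>\<Gamma> + H ^ 4 * \<tau> / v\<^sup>2)"
      using error_ranges by (intro add_left_mono ennreal_leI) simp
    finally show ?thesis .
  qed
  have 2: "T \<le> dirichlet_energy E v \<pi> + ennreal (core_error + \<tau>\<Gamma> + H ^ 4 * \<tau> / v\<^sup>2)"
  proof -
    have pt: "?V z \<le> jump_energy z + (ennreal core_error + ?ind z * ennreal (H ^ 4 / v\<^sup>2))" if "z \<in> Z" for z
    proof (cases "z \<in> cr")
      case True
      then show ?thesis using core_jump_energy(2)[OF True] by simp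
    next
      case False
      have "?V z \<le> ennreal (H ^ 4 / v\<^sup>2)"
        using post_variance_sq_le[OF that] by (intro ennreal_leI divide_right_mono) auto
      then show ?thesis using False by (simp add: add_increasing)
    qed
    have "T \<le> (\<integral>\<^sup>+z. ?M z * jump_energy z + (?M z * ennreal core_error + ?M z * (?ind z * ennreal (H ^ 4 / v\<^sup>2))) \<partial>count_space Z)"
      unfolding T_def distrib_left[symmetric] by (intro nn_integral_mono mult_left_mono pt) auto
    also have "\<dots> = dirichlet_energy E v \<pi> + (ennreal core_error + (\<integral>\<^sup>+z. ?M z * (?ind z * ennreal (H ^ 4 / v\<^sup>2)) \<partial>count_space Z))"
      by (simp add: nn_integral_add D_eq const del: nn_integral_multc)
    also have "\<dots> \<le> dirichlet_energy E v \<pi> + (ennreal core_error + ennreal (H ^ 4 * \<tau> / v\<^sup>2))"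
      by (intro add_left_mono off_var)
    also have "ennreal core_error + ennreal (H ^ 4 * \<tau> / v\<^sup>2) = ennreal (core_error + H ^ 4 * \<tau> / v\<^sup>2)"
      using core_error_nonneg error_ranges by (simp add: ennreal_plus)
    also have "dirichlet_energy E v \<pi> + ennreal (core_error + H ^ 4 * \<tau> / v\<^sup>2) \<le> dirichlet_energy E v \<pi> + ennreal (core_error + \<tau>\<Gamma> + H ^ 4 * \<tau> / v\<^sup>2)"
      using error_ranges by (intro add_left_mono ennreal_leI) simp
    finally show ?thesis .
  qed
  \<comment> \<open>Finiteness of \<open>T\<close>, from the mass bound on \<open>energy\<close>,
    passes to the Dirichlet energy through the upper comparison.\<close>
  have "T < \<infinity>" by (rule le_less_trans[OF Tfin]) simp
  then have "\<bar>enn2real T - enn2real (dirichlet_energy E v \<pi>)\<bar> \<le> core_error + \<tau>\<Gamma> + H ^ 4 * \<tau> / v\<^sup>2"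
    using core_error_nonneg error_ranges by (intro enn2real_diff_le[OF 2 1]) auto
  moreover have "enn2real T = enn2real S / v\<^sup>2"
    using v_pos unfolding T_eq by (simp add: divide_ennreal_def enn2real_mult ennreal_inverse_positive field_simps inverse_ennreal)
  ultimately show ?thesis by (simp add: S_def abs_minus_commute)
qed

section \<open>Collecting the errors and the constants\<close>

lemma risk_diff:
  "\<bar>risk_E E v \<pi> - risk_G v \<pi>\<bar> \<le> 4 * H\<^sup>2 * (2 * \<epsilon> + \<tau> + \<kappa> * sqrt (2 / (pi * v)) + \<beta>)"
  unfolding risk_E_eq risk_G_eq[OF v_pos]
  by (rule risk_functional_transfer(2)[OF risk_functional_spread])

lemma energy_diff:
  "\<bar>enn2real (dirichlet_energy E v \<pi>) - gauss_energy v \<pi>\<bar>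
   \<le> energy_const * \<xi> + H ^ 4 * \<gamma> + \<tau>\<Gamma> + H ^ 4 * \<tau> / v\<^sup>2
     + 9 * H ^ 4 * (2 * \<epsilon> + \<tau> + \<kappa> * sqrt (2 / (pi * v)) + \<beta>) / v\<^sup>2"
proof -
  let ?S = "enn2real (\<integral>\<^sup>+z. ennreal (energy \<pi> (\<lambda>h. p h z)) \<partial>count_space Z)"
    and ?J = "enn2real (\<integral>\<^sup>+y. ennreal (energy \<pi> (\<lambda>h. g h y)) \<partial>lborel)"
  have "\<bar>?S / v\<^sup>2 - ?J / v\<^sup>2\<bar> = \<bar>?S - ?J\<bar> / v\<^sup>2"
    by (simp flip: diff_divide_distrib)
  also have "\<dots> \<le> 9 * H ^ 4 * (2 * \<epsilon> + \<tau> + \<kappa> * sqrt (2 / (pi * v)) + \<beta>) / v\<^sup>2"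
    by (intro divide_right_mono risk_functional_transfer(2)[OF risk_functional_energy]) simp
  finally show ?thesis
    using dirichlet_energy_diff unfolding gauss_energy_eq[OF v_pos] core_error_def by linarith
qed

end

text \<open>Raises the quadrature factors H^2 and H^4 to the stated 1 + H^3 and 1 + H^5, for small H
  as well.\<close>

lemma power_le_one_plus_power:
  fixes H :: real
  assumes "0 \<le> H" "i \<le> j"
  shows "H ^ i \<le> 1 + H ^ j"
proof (cases "H \<le> 1")
  case True
  then show ?thesis using assms power_le_one[of H i] zero_le_power[of H j] by linarith
next
  case False
  then have "H ^ i \<le> H ^ j" using assms by (intro power_increasing) auto
  then show ?thesis by simp
qed

text \<open>A convergent sequence is bounded, say by b, and H \<ge> 1 gives b \<le> b H^4; the
  additive error in the derivative bound is thus absorbed by enlarging \<open>CK\<close> by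
  \<open>C * b\<close>. The subrange \<open>S\<close> is where the second error tends to zero
  uniformly in H.\<close>

lemma DGT_of_bounded_error:
  assumes bound: "\<And>n H v \<pi>. H \<in> R n \<Longrightarrow> v \<in> K \<Longrightarrow> prior H \<pi> \<Longrightarrow>
      \<bar>risk_E (E n) v \<pi> - risk_G v \<pi>\<bar> \<le> \<eta>0 n H \<and>
      (\<exists>D. ((\<lambda>u. risk_E (E n) u \<pi>) has_real_derivative D) (at v within K) \<and>
        \<bar>D - gauss_energy v \<pi>\<bar> \<le> \<eta>1 n H \<and> 0 \<le> D \<and> D \<le> CK * H ^ 4 + C * \<eta>1 n H)"
    and dual: "\<And>n H. H \<in> R n \<Longrightarrow> bayes_minimax_duality K (E n) H"
    and C: "0 < C" and S: "\<And>n. S n \<subseteq> R n \<inter> {1..}"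
    and e: "\<And>n H. H \<in> S n \<Longrightarrow> \<eta>1 n H \<le> e n" "e \<longlonglongrightarrow> 0"
  shows "\<exists>CK'\<ge>CK. DGT K E S CK' \<eta>0 \<eta>1"
proof -
  have "Bseq e" using e(2) by (intro convergent_imp_Bseq) (auto simp: convergent_def)
  then obtain b where b: "0 < b" "\<And>n. \<bar>e n\<bar> \<le> b" by (auto simp: Bseq_def)
  have "DGT K E S (CK + C * b) \<eta>0 \<eta>1"
    unfolding DGT_def
  proof (intro allI ballI conjI impI)
    fix n H assume HS: "H \<in> S n"
    then have H: "H \<in> R n" "1 \<le> H" using S[of n] by auto
    show "bayes_minimax_duality K (E n) H" using H by (intro dual)
    fix v \<pi> assume v: "v \<in> K" and p: "prior H \<pi>"
    show "\<bar>risk_E (E n) v \<pi> - risk_G v \<pi>\<bar> \<le> \<eta>0 n H" using bound[OF H(1) v p] by blast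
    obtain D where D: "((\<lambda>u. risk_E (E n) u \<pi>) has_real_derivative D) (at v within K)"
      "\<bar>D - gauss_energy v \<pi>\<bar> \<le> \<eta>1 n H" "0 \<le> D" "D \<le> CK * H ^ 4 + C * \<eta>1 n H"
      using bound[OF H(1) v p] by blast
    have "\<eta>1 n H \<le> b" using e(1)[OF HS] b(2)[of n] by linarith
    also have "b \<le> b * H ^ 4" using b(1) H(2) by simp
    finally have "C * \<eta>1 n H \<le> C * (b * H ^ 4)" using C by (intro mult_left_mono) auto
    then have "D \<le> (CK + C * b) * H ^ 4" using D(4) by (simp add: algebra_simps)
    then show "\<exists>D. ((\<lambda>u. risk_E (E n) u \<pi>) has_real_derivative D) (at v within K) \<and>
        0 \<le> D \<and> D \<le> (CK + C * b) * H ^ 4 \<and> \<bar>D - gauss_energy v \<pi>\<bar> \<le> \<eta>1 n H"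
      using D by blast
  qed
  moreover have "CK \<le> CK + C * b" using C b(1) by simp
  ultimately show ?thesis by blast
qed

theorem theorem4p4:
  fixes lo hi C0 c0 :: real and K :: "real set"
    and E :: "nat \<Rightarrow> 'z plg_model" and R :: "nat \<Rightarrow> real set"
    and \<epsilon> \<tau> \<tau>\<Gamma> \<beta> \<gamma> \<xi> :: "nat \<Rightarrow> real \<Rightarrow> real" and \<kappa> :: "nat \<Rightarrow> real"
  assumes "0 < lo" "lo < hi" and K: "K = {lo..hi}"
    and "\<And>n H. H \<in> R n \<Longrightarrow> 0 < H"
    and "\<And>n H. H \<in> R n \<Longrightarrow> lattice_experiment K (E n) H"
    and "\<And>n H. H \<in> R n \<Longrightarrow> PLG1 K C0 (E n) H (\<epsilon> n H)"
    and "\<And>n H. H \<in> R n \<Longrightarrow> PLG2 K C0 (E n) H (\<tau> n H) (\<tau>\<Gamma> n H)"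
    and "\<And>n H. H \<in> R n \<Longrightarrow> PLG3 K (E n) H (\<kappa> n) (\<beta> n H)"
    and "\<And>n H. H \<in> R n \<Longrightarrow> PLG4 K C0 c0 (E n) H (\<gamma> n H) (\<xi> n H)"
    and "\<And>n H. H \<in> R n \<Longrightarrow> bayes_minimax_duality K (E n) H"
    and "\<And>n H. H \<in> R n \<Longrightarrow> posterior_dirichlet_identity K (E n) H"
  shows "\<exists>\<eta>0 \<eta>1 C CK. 0 < C \<and> 0 < CK \<and>
    (\<forall>n. \<forall>H\<in>R n.
      (\<forall>v\<in>K. \<forall>\<pi>. prior H \<pi> \<longrightarrow>
        \<bar>risk_E (E n) v \<pi> - risk_G v \<pi>\<bar> \<le> \<eta>0 n H \<and>
        (\<exists>D. ((\<lambda>u. risk_E (E n) u \<pi>) has_real_derivative D) (at v within K) \<and>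
             \<bar>D - gauss_energy v \<pi>\<bar> \<le> \<eta>1 n H \<and>
             0 \<le> D \<and> D \<le> CK * H ^ 4 + C * \<eta>1 n H)) \<and>
      \<eta>0 n H \<le> C * (H\<^sup>2 * \<epsilon> n H + \<kappa> n * (1 + H ^ 3) + H\<^sup>2 * (\<tau> n H + \<beta> n H)) \<and>
      \<eta>1 n H \<le> C * (H ^ 4 * \<epsilon> n H + \<kappa> n * (1 + H ^ 5)
                    + H ^ 4 * (\<tau> n H + \<beta> n H + \<gamma> n H) + \<xi> n H + \<tau>\<Gamma> n H)) \<and>
    (\<forall>S e. (\<forall>n. S n \<subseteq> R n \<inter> {1..}) \<and> (\<forall>n. \<forall>H\<in>S n. \<eta>1 n H \<le> e n) \<and> e \<longlonglongrightarrow> 0 \<longrightarrow>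
      (\<exists>CK'\<ge>CK. DGT K E S CK' \<eta>0 \<eta>1))"
proof -
  \<comment> \<open>The total variation of the Gaussian density at the smallest level, where it is
    largest.\<close>
  define c where "c = sqrt (2 / (pi * lo))"
  define L where "L = 2 * edge_const (max c0 0) + (edge_const (max c0 0))\<^sup>2"
  \<comment> \<open>From the risk come 8 = 4 * 2 for \<epsilon> and 4 c for \<kappa>;
    \<open>L\<close> belongs to \<xi>; the energy gives 18 = 9 * 2 for \<epsilon> and 9 c for
    \<kappa>, both over lo^2, which bounds 1/v^2.\<close>
  define C where "C = 8 + 4 * c + L + (18 + 9 * c) / lo\<^sup>2"
  \<comment> \<open>The errors are taken equal to the claimed bounds, so they depend on neither the
    level nor the prior, and the two inequalities for them are equalities.\<close>
  define \<eta>0 where "\<eta>0 n H = C * (H\<^sup>2 * \<epsilon> n H + \<kappa> n * (1 + H ^ 3) + H\<^sup>2 * (\<tau> n H + \<beta> n H))" for n H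
  define \<eta>1 where "\<eta>1 n H = C * (H ^ 4 * \<epsilon> n H + \<kappa> n * (1 + H ^ 5)
      + H ^ 4 * (\<tau> n H + \<beta> n H + \<gamma> n H) + \<xi> n H + \<tau>\<Gamma> n H)" for n H
  have c: "0 \<le> c" and L: "0 \<le> L"
    using assms(1) edge_const_nonneg[of "max c0 0"] by (auto simp: c_def L_def)
  have lo2: "0 < lo\<^sup>2" using assms(1) by simp
  have C_ge: "8 \<le> C" "4 * c \<le> C" "L \<le> C" "18 / lo\<^sup>2 \<le> C" "9 * c / lo\<^sup>2 \<le> C" "1 \<le> C"
    using c L lo2 by (auto simp: C_def add_divide_distrib intro!: add_nonneg_nonneg add_increasing divide_right_mono)
  have main: "\<bar>risk_E (E n) v \<pi> - risk_G v \<pi>\<bar> \<le> \<eta>0 n H \<and>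
      (\<exists>D. ((\<lambda>u. risk_E (E n) u \<pi>) has_real_derivative D) (at v within K) \<and>
        \<bar>D - gauss_energy v \<pi>\<bar> \<le> \<eta>1 n H \<and> 0 \<le> D \<and> D \<le> (1 / lo\<^sup>2) * H ^ 4 + C * \<eta>1 n H)"
    if H: "H \<in> R n" and v: "v \<in> K" and p: "prior H \<pi>" for n H v \<pi>
  proof -
    have vl: "lo \<le> v" and v0: "0 < v" using v assms(1) K by auto
    interpret plg_level H \<pi> K C0 c0 v "\<epsilon> n H" "\<tau> n H" "\<tau>\<Gamma> n H" "\<kappa> n" "\<beta> n H" "\<gamma> n H" "\<xi> n H" "E n"
      by unfold_locales (use assms H v v0 p in auto)
    note r = error_ranges
    let ?c = "sqrt (2 / (pi * v))"
    have cv: "?c \<le> c" "0 \<le> ?c" unfolding c_def using vl assms(1) by (auto intro!: divide_left_mono)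
    have v2: "1 / v\<^sup>2 \<le> 1 / lo\<^sup>2" using vl assms(1) by (intro divide_left_mono power_mono) auto
    have p2: "H\<^sup>2 \<le> 1 + H ^ 3" "H ^ 4 \<le> 1 + H ^ 5" using H_pos by (auto intro: power_le_one_plus_power)
    define s where "s = 2 * \<epsilon> n H + \<tau> n H + \<kappa> n * c + \<beta> n H"
    have s: "2 * \<epsilon> n H + \<tau> n H + \<kappa> n * ?c + \<beta> n H \<le> s" "0 \<le> s"
      using r cv c by (auto simp: s_def intro!: mult_left_mono)
    have k2: "c * (\<kappa> n * H\<^sup>2) \<le> c * (\<kappa> n * (1 + H ^ 3))" "c * (\<kappa> n * H ^ 4) \<le> c * (\<kappa> n * (1 + H ^ 5))"
      using c r p2 by (auto intro!: mult_left_mono)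
    have "\<bar>risk_E (E n) v \<pi> - risk_G v \<pi>\<bar> \<le> 4 * H\<^sup>2 * s"
      using risk_diff mult_left_mono[OF s(1), of "4 * H\<^sup>2"] by simp
    also have "\<dots> = 8 * (H\<^sup>2 * \<epsilon> n H) + 4 * (H\<^sup>2 * (\<tau> n H + \<beta> n H)) + 4 * (c * (\<kappa> n * H\<^sup>2))"
      by (simp add: s_def algebra_simps)
    also have "\<dots> \<le> C * (H\<^sup>2 * \<epsilon> n H) + C * (H\<^sup>2 * (\<tau> n H + \<beta> n H)) + C * (\<kappa> n * (1 + H ^ 3))"
    proof (intro add_mono)
      show "4 * (c * (\<kappa> n * H\<^sup>2)) \<le> C * (\<kappa> n * (1 + H ^ 3))"
        using k2(1) mult_right_mono[OF C_ge(2), of "\<kappa> n * (1 + H ^ 3)"] r H_pos by (simp add: mult.assoc)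
    qed (use C_ge r in \<open>auto intro!: mult_right_mono\<close>)
    also have "\<dots> = \<eta>0 n H" by (simp add: \<eta>0_def algebra_simps)
    finally have e0: "\<bar>risk_E (E n) v \<pi> - risk_G v \<pi>\<bar> \<le> \<eta>0 n H" .
    let ?D = "enn2real (dirichlet_energy (E n) v \<pi>)"
    have t1: "9 * H ^ 4 * (2 * \<epsilon> n H + \<tau> n H + \<kappa> n * ?c + \<beta> n H) / v\<^sup>2 \<le> 9 * H ^ 4 * s / lo\<^sup>2"
      using s vl assms(1) by (intro frac_le mult_left_mono power_mono) auto
    have t2: "H ^ 4 * \<tau> n H / v\<^sup>2 \<le> H ^ 4 * \<tau> n H / lo\<^sup>2"
      using r vl assms(1) by (intro divide_left_mono power_mono) auto
    have "\<bar>?D - gauss_energy v \<pi>\<bar> \<le> L * \<xi> n H + H ^ 4 * \<gamma> n H + \<tau>\<Gamma> n H + H ^ 4 * \<tau> n H / lo\<^sup>2 + 9 * H ^ 4 * s / lo\<^sup>2"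
      using energy_diff t1 t2 by (simp add: L_def)
    \<comment> \<open>In 10 / lo^2 nine units come from the Lipschitz constant and one from the
      off-core variance. As 10 \<le> 18, \<open>C\<close> needs no separate summand for it.\<close>
    also have "\<dots> = L * \<xi> n H + 1 * (H ^ 4 * \<gamma> n H) + 1 * \<tau>\<Gamma> n H + 10 / lo\<^sup>2 * (H ^ 4 * \<tau> n H)
        + 18 / lo\<^sup>2 * (H ^ 4 * \<epsilon> n H) + 9 / lo\<^sup>2 * (H ^ 4 * \<beta> n H) + 9 / lo\<^sup>2 * (c * (\<kappa> n * H ^ 4))"
      by (simp add: s_def add_divide_distrib algebra_simps)
    also have "\<dots> \<le> C * \<xi> n H + C * (H ^ 4 * \<gamma> n H) + C * \<tau>\<Gamma> n H + C * (H ^ 4 * \<tau> n H)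
        + C * (H ^ 4 * \<epsilon> n H) + C * (H ^ 4 * \<beta> n H) + C * (\<kappa> n * (1 + H ^ 5))"
    proof (intro add_mono)
      have "9 / lo\<^sup>2 * (c * (\<kappa> n * H ^ 4)) \<le> 9 / lo\<^sup>2 * (c * (\<kappa> n * (1 + H ^ 5)))"
        using k2(2) by (rule mult_left_mono) simp
      also have "\<dots> = 9 * c / lo\<^sup>2 * (\<kappa> n * (1 + H ^ 5))" by simp
      also have "\<dots> \<le> C * (\<kappa> n * (1 + H ^ 5))" using C_ge r H_pos by (intro mult_right_mono) auto
      finally show "9 / lo\<^sup>2 * (c * (\<kappa> n * H ^ 4)) \<le> C * (\<kappa> n * (1 + H ^ 5))" .
      have "9 / lo\<^sup>2 \<le> 18 / lo\<^sup>2" "10 / lo\<^sup>2 \<le> 18 / lo\<^sup>2" by (intro divide_right_mono; simp)+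
      then have "9 / lo\<^sup>2 \<le> C" "10 / lo\<^sup>2 \<le> C" using C_ge(4) by linarith+
      then show "10 / lo\<^sup>2 * (H ^ 4 * \<tau> n H) \<le> C * (H ^ 4 * \<tau> n H)"
        "9 / lo\<^sup>2 * (H ^ 4 * \<beta> n H) \<le> C * (H ^ 4 * \<beta> n H)"
        using r by (intro mult_right_mono; simp)+
    qed (rule mult_right_mono; use C_ge r in simp)+
    also have "\<dots> = \<eta>1 n H" by (simp add: \<eta>1_def algebra_simps)
    finally have e1: "\<bar>?D - gauss_energy v \<pi>\<bar> \<le> \<eta>1 n H" .
    have "posterior_dirichlet_identity K (E n) H" using assms H by blast
    then have der: "((\<lambda>u. risk_E (E n) u \<pi>) has_real_derivative ?D) (at v within K)"
      using p v by (simp add: posterior_dirichlet_identity_def)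
    \<comment> \<open>A posterior variance is at most H^2; hence the witness 1 / lo^2 for
      \<open>CK\<close>.\<close>
    have "gauss_energy v \<pi> \<le> (1 / lo\<^sup>2) * H ^ 4"
      using gauss_energy_le[OF v0] mult_right_mono[OF v2, of "H ^ 4"] by simp
    \<comment> \<open>The second error is nonnegative because it dominates an absolute value, so
      \<open>1 \<le> C\<close> suffices.\<close>
    moreover have "\<eta>1 n H \<le> C * \<eta>1 n H"
      using mult_right_mono[OF C_ge(6), of "\<eta>1 n H"] e1 by simp
    ultimately have "?D \<le> (1 / lo\<^sup>2) * H ^ 4 + C * \<eta>1 n H" using e1 by linarith
    then show ?thesis using e0 e1 der by (meson enn2real_nonneg)
  qed
  show ?thesis
  proof (rule exI[of _ \<eta>0], rule exI[of _ \<eta>1], rule exI[of _ C], rule exI[of _ "1 / lo\<^sup>2"],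
      intro conjI allI ballI impI)
    show "0 < C" "0 < 1 / lo\<^sup>2" using C_ge lo2 by auto
    show "\<exists>CK'\<ge>1 / lo\<^sup>2. DGT K E S CK' \<eta>0 \<eta>1"
      if "(\<forall>n. S n \<subseteq> R n \<inter> {1..}) \<and> (\<forall>n. \<forall>H\<in>S n. \<eta>1 n H \<le> e n) \<and> e \<longlonglongrightarrow> 0" for S e
      by (rule DGT_of_bounded_error[where R = R and e = e, OF main]) (use that assms \<open>0 < C\<close> in auto)
  qed ((rule main[THEN conjunct1] main[THEN conjunct2]; assumption) | simp add: \<eta>0_def \<eta>1_def)+
qed

end
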